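(* Let $\lambda$ be a Salem number. Then for each odd integer $n\ge 3$, there exist an arithmetic lattice $\Gamma\subseteq\mathrm{Isom}(H^n)$ of the simplest type defined over $\mathbb{Q}(\lambda+\lambda^{-1})$ and a hyperbolic element $\gamma$ of $\Gamma$ such that $\lambda^{1/2}=e^{\ell(\gamma)}$.
   Context: A Salem number is a real algebraic integer $\lambda>1$ that is conjugate (over $\mathbb{Q}$) to $\lambda^{-1}$ and whose remaining conjugates lie on the unit circle; degree $2$ is allowed. (The field $\mathbb{Q}(\lambda+\lambda^{-1})$ is then totally real.) Let $f_n(x)=x_1^2+\cdots+x_n^2-x_{n+1}^2$ and $H^n=\{x\in\mathbb{R}^{n+1}: f_n(x)=-1,\ x_{n+1}>0\}$ (hyperboloid model of hyperbolic $n$-space). $\mathrm{O}^+(n,1)$ is the group of real matrices preserving $f_n$ and leaving $H^n$ invariant; it is identified with $\mathrm{Isom}(H^n)$. An element $\gamma\in\mathrm{Isom}(H^n)$ is hyperbolic if there is a unique geodesic in $H^n$ (its axis) along which $\gamma$ acts as a translation by a positive distance $\ell(\gamma)$, called the translation length of $\gamma$. Totally real number fields $K$ are taken as subfields of $\mathbb{R}$, with ring of integers $\mathfrak{o}_K$. A quadratic form $f(x)=x^tAx$ over $K$ in $n+1$ variables (with $A$ a symmetric matrix over $K$) is admissible if $f$ has signature $(n,1)$ and, for each nonidentity embedding $\sigma:K\to\mathbb{R}$, the form $f^\sigma$ obtained by applying $\sigma$ to the entries of $A$ is positive definite. For a subring $R\subseteq\mathbb{R}$, $\mathrm{O}'(f,R)$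 is the group of $T\in\mathrm{GL}(n+1,R)$ with $T^tAT=A$ that leave invariant both components of the cone $\{x\in\mathbb{R}^{n+1}:f(x)<0\}$. A subgroup $\Gamma\subseteq\mathrm{O}^+(n,1)=\mathrm{Isom}(H^n)$ is an arithmetic lattice of the simplest type defined over $K$ if there exist an admissible quadratic form $f$ over $K$ in $n+1$ variables and $M\in\mathrm{GL}(n+1,\mathbb{R})$ such that $f(Mx)=f_n(x)$ for all $x\in\mathbb{R}^{n+1}$ and $M\Gamma M^{-1}$ is commensurable with $\mathrm{O}'(f,\mathfrak{o}_K)$ (their intersection has finite index in both). *)

theory Defs
  imports
    "HOL-Analysis.Analysis"
    "HOL-Computational_Algebra.Computational_Algebra"
    "HOL-Algebra.Coset"
begin

subsection \<open>Number fields inside the reals\<close>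

definition conjugate_over_rat :: "complex \<Rightarrow> complex \<Rightarrow> bool" where
  "conjugate_over_rat z w \<longleftrightarrow>
     (\<exists>p :: rat poly. irreducible p \<and>
        poly (map_poly of_rat p) z = 0 \<and> poly (map_poly of_rat p) w = 0)"

definition salem_number :: "real \<Rightarrow> bool" where
  "salem_number a \<longleftrightarrow>
     algebraic_int a \<and> a > 1 \<and>
     conjugate_over_rat (of_real a) (of_real (inverse a)) \<and>
     (\<forall>z. conjugate_over_rat (of_real a) z \<and> z \<noteq> of_real a \<and> z \<noteq> of_real (inverse a)
        \<longrightarrow> cmod z = 1)"

definition real_subfield :: "real set \<Rightarrow> bool" where
  "real_subfield K \<longleftrightarrow>
     0 \<in> K \<and> 1 \<in> K \<and>
     (\<forall>x\<in>K. \<forall>y\<in>K. x + y \<in> K \<and> x * y \<in> K) \<and>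
     (\<forall>x\<in>K. - x \<in> K \<and> inverse x \<in> K)"

text \<open>The field generated by \<open>a\<close> over the rationals, as a subfield of the reals; every subfield of
  the reals contains the rationals.\<close>

definition rat_adjoin :: "real \<Rightarrow> real set" where
  "rat_adjoin a = \<Inter> {K. real_subfield K \<and> a \<in> K}"

text \<open>Embeddings are total functions of which only the restriction to \<open>K\<close> matters.\<close>

definition field_embedding :: "real set \<Rightarrow> (real \<Rightarrow> 'a::field) \<Rightarrow> bool" where
  "field_embedding K \<sigma> \<longleftrightarrow>
     \<sigma> 1 = 1 \<and> (\<forall>x\<in>K. \<forall>y\<in>K. \<sigma> (x + y) = \<sigma> x + \<sigma> y \<and> \<sigma> (x * y) = \<sigma> x * \<sigma> y)"

definition number_field :: "real set \<Rightarrow> bool" where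
  "number_field K \<longleftrightarrow>
     real_subfield K \<and>
     (\<exists>B. finite B \<and> B \<subseteq> K \<and>
        (\<forall>x\<in>K. \<exists>c :: real \<Rightarrow> rat. x = (\<Sum>b\<in>B. of_rat (c b) * b)))"

definition totally_real_number_field :: "real set \<Rightarrow> bool" where
  "totally_real_number_field K \<longleftrightarrow>
     number_field K \<and>
     (\<forall>\<sigma> :: real \<Rightarrow> complex. field_embedding K \<sigma> \<longrightarrow> \<sigma> ` K \<subseteq> \<real>)"

definition ring_of_integers :: "real set \<Rightarrow> real set" where
  "ring_of_integers K = {x \<in> K. algebraic_int x}"


subsection \<open>Hyperbolic space\<close>

text \<open>Points of $\mathbb{R}^{n+1}$ are vectors indexed by \<open>'n option\<close> with \<open>n = CARD('n)\<close>:
  the components \<open>Some i\<close> are $x_1,\dots,x_n$ and \<open>None\<close> is the last one, $x_{n+1}$.\<close>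

definition lorentz_inner :: "real^('n::finite option) \<Rightarrow> real^('n option) \<Rightarrow> real" where
  "lorentz_inner x y = (\<Sum>i\<in>UNIV. x $ Some i * y $ Some i) - x $ None * y $ None"

definition lorentz_form :: "real^('n::finite option) \<Rightarrow> real" where
  "lorentz_form x = (\<Sum>i\<in>UNIV. (x $ Some i)\<^sup>2) - (x $ None)\<^sup>2"

definition hyp_space :: "(real^('n::finite option)) set" where
  "hyp_space = {x. lorentz_form x = -1 \<and> x $ None > 0}"

definition hyp_dist :: "real^('n::finite option) \<Rightarrow> real^('n option) \<Rightarrow> real" where
  "hyp_dist x y = arcosh (- lorentz_inner x y)"

definition O_plus :: "(real^('n::finite option)^('n option)) set" where
  "O_plus = {T. (\<forall>x. lorentz_form (T *v x) = lorentz_form x) \<and> (*v) T ` hyp_space = hyp_space}"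

definition unit_speed_geodesic :: "(real \<Rightarrow> real^('n::finite option)) \<Rightarrow> bool" where
  "unit_speed_geodesic c \<longleftrightarrow> range c \<subseteq> hyp_space \<and> (\<forall>s t. hyp_dist (c s) (c t) = \<bar>s - t\<bar>)"

definition translates_along ::
  "real^('n::finite option)^('n option) \<Rightarrow> (real^('n option)) set \<Rightarrow> real \<Rightarrow> bool" where
  "translates_along T L l \<longleftrightarrow>
     (\<exists>c. unit_speed_geodesic c \<and> range c = L \<and> (\<forall>t. T *v c t = c (t + l)))"

definition hyperbolic_element :: "real^('n::finite option)^('n option) \<Rightarrow> bool" where
  "hyperbolic_element T \<longleftrightarrow> T \<in> O_plus \<and> (\<exists>!L. \<exists>l>0. translates_along T L l)"

definition translation_length :: "real^('n::finite option)^('n option) \<Rightarrow> real" where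
  "translation_length T = (THE l. l > 0 \<and> (\<exists>L. translates_along T L l))"


subsection \<open>Quadratic forms\<close>

definition qform :: "real^'k::finite^'k \<Rightarrow> real^'k \<Rightarrow> real" where
  "qform A x = x \<bullet> (A *v x)"

definition has_signature :: "real^'k::finite^'k \<Rightarrow> nat \<Rightarrow> nat \<Rightarrow> bool" where
  "has_signature A p q \<longleftrightarrow>
     p + q = CARD('k) \<and>
     (\<exists>P :: real^'k^'k. invertible P \<and>
        (\<forall>i j. i \<noteq> j \<longrightarrow> (transpose P ** A ** P) $ i $ j = 0) \<and>
        card {i. (transpose P ** A ** P) $ i $ i > 0} = p \<and>
        card {i. (transpose P ** A ** P) $ i $ i < 0} = q)"

definition positive_definite :: "real^'k::finite^'k \<Rightarrow> bool" where
  "positive_definite A \<longleftrightarrow> (\<forall>x::real^'k. x \<noteq> 0 \<longrightarrow> qform A x > 0)"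

definition admissible_form :: "real set \<Rightarrow> real^('n::finite option)^('n option) \<Rightarrow> bool" where
  "admissible_form K A \<longleftrightarrow>
     (\<forall>i j. A $ i $ j \<in> K) \<and> transpose A = A \<and>
     has_signature A CARD('n) 1 \<and>
     (\<forall>\<sigma> :: real \<Rightarrow> real. field_embedding K \<sigma> \<and> (\<exists>x\<in>K. \<sigma> x \<noteq> x)
        \<longrightarrow> positive_definite (\<chi> i j. \<sigma> (A $ i $ j)))"


subsection \<open>Arithmetic lattices of the simplest type\<close>

definition GL_real :: "(real^'k::finite^'k) monoid" where
  "GL_real = \<lparr>carrier = {T. invertible T}, mult = (**), one = mat 1\<rparr>"

definition GL_over :: "real set \<Rightarrow> (real^'k::finite^'k) set" where
  "GL_over R = {T. invertible T \<and> (\<forall>i j. T $ i $ j \<in> R \<and> matrix_inv T $ i $ j \<in> R)}"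

definition O_prime :: "real^'k::finite^'k \<Rightarrow> real set \<Rightarrow> (real^'k^'k) set" where
  "O_prime A R = {T \<in> GL_over R. transpose T ** A ** T = A \<and>
     (\<forall>C \<in> components {x. qform A x < 0}. (*v) T ` C = C)}"

definition commensurable :: "('a, 'b) monoid_scheme \<Rightarrow> 'a set \<Rightarrow> 'a set \<Rightarrow> bool" where
  "commensurable G H1 H2 \<longleftrightarrow>
     finite (rcosets\<^bsub>G\<lparr>carrier := H1\<rparr>\<^esub> (H1 \<inter> H2)) \<and>
     finite (rcosets\<^bsub>G\<lparr>carrier := H2\<rparr>\<^esub> (H1 \<inter> H2))"

definition simplest_type_lattice ::
  "real set \<Rightarrow> (real^('n::finite option)^('n option)) set \<Rightarrow> bool" where
  "simplest_type_lattice K \<Gamma> \<longleftrightarrow>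
     totally_real_number_field K \<and>
     subgroup \<Gamma> GL_real \<and> \<Gamma> \<subseteq> O_plus \<and>
     (\<exists>A M :: real^('n option)^('n option). admissible_form K A \<and> invertible M \<and>
        (\<forall>x. qform A (M *v x) = lorentz_form x) \<and>
        commensurable GL_real ((\<lambda>T. M ** T ** matrix_inv M) ` \<Gamma>)
          (O_prime A (ring_of_integers K)))"

end

theory Submission
  imports Defs "HOL-Computational_Algebra.Field_as_Ring"
begin

text \<open>
  Put \<open>y = lam + 1/lam\<close>, \<open>a = y + 2\<close> and \<open>K = \<rat>(y)\<close>. The form
  \<open>x\<^sub>0\<^sup>2 + y x\<^sub>0 x\<^sub>1 + x\<^sub>1\<^sup>2\<close>, extended by \<open>(n - 1)/2\<close> copies of \<open>u\<^sup>2 + a v\<^sup>2\<close>, is admissible,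
  because the nonidentity embeddings send \<open>y\<close> into the open interval from \<open>-2\<close> to \<open>2\<close>. The first
  summand is the norm form of \<open>K(lam)\<close>, so multiplication by \<open>1 + lam\<close> scales it by \<open>a\<close>, as does
  \<open>(u, v) \<mapsto> (- a v, u)\<close> each of the other summands. The resulting integral similitude \<open>T\<close> divided by
  the square root of \<open>a\<close> is an isometry \<open>t\<close>, hyperbolic of translation length \<open>ln lam / 2\<close>. It does not
  have integral entries, but \<open>t\<^sup>2\<close> does. Let \<open>H\<close> be the group of integral isometries and
  \<open>D = H \<inter> t H t\<^sup>-\<^sup>1\<close>: this group has finite index in \<open>H\<close>, as it contains the principal congruence
  subgroup of level \<open>a\<close>, and it is normalised by \<open>t\<close>, so that \<open>D \<union> t D\<close> is the lattice sought.
\<close>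

text \<open>Multiplication by lam is an isometry of the norm form and translates by ln lam, so it is
  this translation that has to be halved. The constant a comes from (1 + lam)^2 = a lam: up to the
  scalar sqrt a, the factor 1 + lam is a square root of lam. Since sqrt a need not lie in K, the
  isometry t need not be defined over K, and the arithmetic is done on the similitude T.

  A similitude of multiplier a satisfies det(T)^2 = a^(n+1), so for even n the number a would have
  to be a square in K; this is where odd n enters. The added planes must carry similitudes of the
  same multiplier: u^2 + a v^2 is the norm form of K(sqrt(-a)), multiplication by sqrt(-a) is such a
  similitude, and the form stays definite under every embedding.

  Finiteness of the index rests on finiteness of the ring of integers modulo a. It is obtained by
  counting classes in additive groups of finite rank, without an integral basis.\<close>

no_notation fps_nth (infixl \<open>$\<close> 75)

section \<open>Subgroups of finite rank and algebraic integers\<close>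

text \<open>The reals as a \<int>-module: \<open>zmod.subspace\<close> means additive subgroup and
  \<open>zmod.span\<close> the subgroup generated by a set.\<close>

interpretation zmod: module "\<lambda>(n::int) (x::real). of_int n * x"
  by unfold_locales (auto simp: algebra_simps)

lemma int_subgroup_principal:
  fixes I :: "int set"
  assumes "0 \<in> I" and sub: "\<And>a b. a \<in> I \<Longrightarrow> b \<in> I \<Longrightarrow> a - b \<in> I"
    and mul: "\<And>a n. a \<in> I \<Longrightarrow> n * a \<in> I"
  shows "\<exists>j\<in>I. \<forall>k\<in>I. j dvd k"
proof (cases "I = {0}")
  case True
  then show ?thesis by auto
next
  case False
  then obtain a where a: "a \<in> I" "a \<noteq> 0" using assms(1) by blast
  define m where "m = (LEAST m::nat. m > 0 \<and> int m \<in> I)"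
  have "\<bar>a\<bar> \<in> I" using a mul[of a "sgn a"] by (simp add: abs_sgn mult.commute)
  then have "\<exists>m::nat. m > 0 \<and> int m \<in> I" using a by (intro exI[of _ "nat \<bar>a\<bar>"]) auto
  then have m: "m > 0" "int m \<in> I" unfolding m_def by (metis (mono_tags, lifting) LeastI_ex)+
  have "int m dvd k" if "k \<in> I" for k
  proof (rule ccontr)
    assume "\<not> int m dvd k"
    then have pos: "k mod int m > 0"
      using m pos_mod_sign[of "int m" k] dvd_eq_mod_eq_0[of "int m" k] by linarith
    have "k mod int m = k - (k div int m) * int m" by (simp add: minus_div_mult_eq_mod)
    then have "k mod int m \<in> I" using sub[OF that mul[OF m(2)]] by simp
    then have "nat (k mod int m) > 0 \<and> int (nat (k mod int m)) \<in> I" using pos by simp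
    then have "m \<le> nat (k mod int m)" unfolding m_def by (rule Least_le)
    moreover have "k mod int m < int m" using m by simp
    ultimately show False using pos by linarith
  qed
  then show ?thesis using m by blast
qed

text \<open>Induction on the generators. The integers occurring as coefficient of \<open>b\<close>
  in elements of \<open>H\<close> form an ideal; an element of \<open>H\<close> that realises a
  generator of this ideal, together with generators of \<open>H \<inter> zmod.span B\<close>,
  generates \<open>H\<close>. Each step costs at most one generator.\<close>

lemma subgroup_of_finitely_generated:
  assumes "finite B" "zmod.subspace H" "H \<subseteq> zmod.span B"
  shows "\<exists>B'. finite B' \<and> card B' \<le> card B \<and> zmod.span B' = H"
  using assms
proof (induction B arbitrary: H rule: finite_induct)
  case empty
  then have "H = {0}" using zmod.subspace_0 by auto
  then show ?case by (intro exI[of _ "{}"]) simp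
next
  case (insert b B)
  \<comment> \<open>\<open>B\<close> may be dependent, so one element of \<open>H\<close> can have
    several coefficients at \<open>b\<close>; \<open>I\<close> collects them all.\<close>
  define I where "I = {k. \<exists>h\<in>H. h - of_int k * b \<in> zmod.span B}"
  note H = insert.prems(1)
  have "\<exists>j\<in>I. \<forall>k\<in>I. j dvd k"
  proof (rule int_subgroup_principal[of I])
    show "0 \<in> I" unfolding I_def using zmod.subspace_0[OF H] zmod.span_zero[of B] by force
    show "a - c \<in> I" if ac: "a \<in> I" "c \<in> I" for a c
    proof -
      obtain g h where g: "g \<in> H" "g - of_int a * b \<in> zmod.span B"
        and h: "h \<in> H" "h - of_int c * b \<in> zmod.span B"
        using ac unfolding I_def by blast
      have "(g - h) - of_int (a - c) * b = (g - of_int a * b) - (h - of_int c * b)"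
        by (simp add: algebra_simps)
      then show ?thesis unfolding I_def
        using zmod.span_diff[OF g(2) h(2)] zmod.subspace_diff[OF H g(1) h(1)]
        by (metis (mono_tags, lifting) mem_Collect_eq)
    qed
    show "n * a \<in> I" if a: "a \<in> I" for n a
    proof -
      obtain g where g: "g \<in> H" "g - of_int a * b \<in> zmod.span B"
        using a unfolding I_def by blast
      have "of_int n * g - of_int (n * a) * b = of_int n * (g - of_int a * b)"
        by (simp add: algebra_simps)
      then show ?thesis unfolding I_def
        using zmod.span_scale[OF g(2), of n] zmod.subspace_scale[OF H g(1), of n]
        by (metis (mono_tags, lifting) mem_Collect_eq)
    qed
  qed
  then obtain j where j: "j \<in> I" "\<And>k. k \<in> I \<Longrightarrow> j dvd k" by blast
  from j(1) obtain g where g: "g \<in> H" "g - of_int j * b \<in> zmod.span B"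
    unfolding I_def by blast
  have "zmod.subspace (H \<inter> zmod.span B)" using H by (simp add: zmod.subspace_inter)
  from insert.IH[OF this] obtain B' where B': "finite B'" "card B' \<le> card B"
    "zmod.span B' = H \<inter> zmod.span B" by auto
  have "zmod.span (insert g B') = H"
  proof
    have "B' \<subseteq> H" using B'(3) zmod.span_superset[of B'] by blast
    then show "zmod.span (insert g B') \<subseteq> H" using g H by (intro zmod.span_minimal) auto
    show "H \<subseteq> zmod.span (insert g B')"
    proof
      fix h assume h: "h \<in> H"
      then obtain k where k: "h - of_int k * b \<in> zmod.span B"
        using insert.prems(2) zmod.span_breakdown_eq by blast
      then have "k \<in> I" unfolding I_def using h by blast
      then obtain q where q: "k = j * q" using j(2) by blast
      have "h - of_int q * g = (h - of_int k * b) - of_int q * (g - of_int j * b)"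
        by (simp add: q algebra_simps)
      also have "\<dots> \<in> zmod.span B" by (intro zmod.span_diff k zmod.span_scale g)
      finally have "h - of_int q * g \<in> zmod.span B'"
        using B'(3) zmod.subspace_diff[OF H h zmod.subspace_scale[OF H g(1), of q]] by simp
      then show "h \<in> zmod.span (insert g B')" unfolding zmod.span_breakdown_eq by blast
    qed
  qed
  moreover have "card (insert g B') \<le> card (insert b B)"
    using B' insert.hyps card_insert_le_m1[of "Suc (card B')" B' g] by (simp add: card_insert_if)
  ultimately show ?case using B'(1) by (intro exI[of _ "insert g B'"]) simp
qed

text \<open>Coefficients are reduced modulo \<open>N\<close>. The bound sees only the number of
  generators, and this uniformity is what carries over to groups that are not finitely
  generated.\<close>

lemma span_finite_mod_nat:
  fixes N :: nat
  assumes "finite B" "N > 0"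
  shows "\<exists>R. finite R \<and> card R \<le> N ^ card B \<and>
    (\<forall>h\<in>zmod.span B. \<exists>r\<in>R. \<exists>k\<in>zmod.span B. h = r + real N * k)"
  using assms(1)
proof (induction B rule: finite_induct)
  case empty
  then show ?case by (intro exI[of _ "{0}"]) simp
next
  case (insert b B)
  then obtain R where R: "finite R" "card R \<le> N ^ card B"
    "\<And>h. h \<in> zmod.span B \<Longrightarrow> \<exists>r\<in>R. \<exists>k\<in>zmod.span B. h = r + real N * k" by blast
  define R' where "R' = (\<lambda>(r, i). r + real i * b) ` (R \<times> {..<N})"
  have "card R' \<le> card (R \<times> {..<N})" unfolding R'_def using R(1) by (intro card_image_le) simp
  also have "\<dots> \<le> N ^ card (insert b B)" using R(2) insert.hyps by (simp add: card_cartesian_product)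
  finally have card: "card R' \<le> N ^ card (insert b B)" .
  have "\<exists>r\<in>R'. \<exists>k\<in>zmod.span (insert b B). h = r + real N * k"
    if h: "h \<in> zmod.span (insert b B)" for h
  proof -
    obtain m where m: "h - of_int m * b \<in> zmod.span B" using h zmod.span_breakdown_eq by blast
    then obtain r k where rk: "r \<in> R" "k \<in> zmod.span B" "h - of_int m * b = r + real N * k"
      using R(3) by blast
    define i where "i = nat (m mod int N)"
    have "m = (m div int N) * int N + int i" using assms(2) by (simp add: i_def)
    then have "real_of_int m = of_int (m div int N) * real N + real i"
      by (metis of_int_add of_int_mult of_int_of_nat_eq)
    then have "h = (r + real i * b) + real N * (k + of_int (m div int N) * b)"
      using rk(3) by (simp add: algebra_simps)
    moreover have "r + real i * b \<in> R'" unfolding R'_def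
      using rk(1) assms(2) by (intro image_eqI[of _ _ "(r, i)"]) (auto simp: i_def nat_less_iff)
    moreover have "k + of_int (m div int N) * b \<in> zmod.span (insert b B)"
      using rk(2) zmod.span_mono[of B "insert b B"] zmod.span_base[of b "insert b B"]
      by (intro zmod.span_add zmod.span_scale) auto
    ultimately show ?thesis by blast
  qed
  moreover have "finite R'" unfolding R'_def using R(1) by simp
  ultimately show ?case using card by blast
qed

lemma common_denominator_in_span:
  fixes x :: real and c :: "real \<Rightarrow> rat"
  assumes "finite B" "x = (\<Sum>b\<in>B. of_rat (c b) * b)"
  obtains D :: nat where "D > 0" "real D * x \<in> zmod.span B"
proof -
  have "\<exists>D::nat. D > 0 \<and> real D * x \<in> zmod.span B"
    using assms
  proof (induction B arbitrary: x rule: finite_induct)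
    case empty
    then show ?case by (intro exI[of _ 1]) simp
  next
    case (insert b B)
    define y where "y = (\<Sum>b\<in>B. of_rat (c b) * b)"
    from insert.IH[OF y_def] obtain D :: nat where D: "D > 0" "real D * y \<in> zmod.span B" by blast
    obtain m n where mn: "quotient_of (c b) = (m, n)" by fastforce
    then have n: "n > 0" using quotient_of_denom_pos by blast
    have "of_rat (c b) = (of_int m / of_int n :: real)"
      using quotient_of_div[OF mn] by (simp add: of_rat_divide)
    then have "real (D * nat n) * x - of_int (int D * m) * b = of_int n * (real D * y)"
      using insert n by (simp add: y_def field_simps)
    then have "real (D * nat n) * x \<in> zmod.span (insert b B)"
      unfolding zmod.span_breakdown_eq using zmod.span_scale[OF D(2), of n] by metis
    then show ?case using D(1) n by (intro exI[of _ "D * nat n"]) auto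
  qed
  then show ?thesis using that by blast
qed

text \<open>A subgroup of a finite-dimensional rational vector space need not be finitely generated, but
  every finite part of it lies in a finitely generated one with a bounded number of generators.\<close>

lemma finite_rank_subgroup_mod_nat:
  fixes N :: nat
  assumes "finite B" "N > 0" and H: "zmod.subspace H"
    and span: "\<And>x. x \<in> H \<Longrightarrow> \<exists>c :: real \<Rightarrow> rat. x = (\<Sum>b\<in>B. of_rat (c b) * b)"
  obtains R where "finite R" "R \<subseteq> H" "\<And>h. h \<in> H \<Longrightarrow> \<exists>r\<in>R. \<exists>k\<in>H. h = r + real N * k"
proof -
  \<comment> \<open>The members of \<open>S\<close> are pairwise incongruent modulo N H. The aim is
    a bound on \<open>card S\<close> common to all such \<open>S\<close>.\<close>
  define indep where "indep S \<longleftrightarrow> finite S \<and> S \<subseteq> H \<and>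
    (\<forall>s\<in>S. \<forall>s'\<in>S. \<forall>k\<in>H. s = s' + real N * k \<longrightarrow> s = s')" for S
  have bound: "card S \<le> N ^ card B" if S: "indep S" for S
  proof -
    have "finite S" "S \<subseteq> H" using S by (auto simp: indep_def)
    then have "\<exists>D::nat. D > 0 \<and> (\<forall>s\<in>S. real D * s \<in> zmod.span B)"
    proof (induction S rule: finite_induct)
      case empty
      then show ?case by (intro exI[of _ 1]) simp
    next
      case (insert s S)
      then obtain D :: nat where D: "D > 0" "\<forall>s\<in>S. real D * s \<in> zmod.span B" by blast
      obtain c where "s = (\<Sum>b\<in>B. of_rat (c b) * b)" using span insert.prems by blast
      then obtain D' :: nat where D': "D' > 0" "real D' * s \<in> zmod.span B"
        using common_denominator_in_span[OF assms(1)] by metis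
      have "real (D * D') * t \<in> zmod.span B" if t: "t \<in> insert s S" for t
      proof (cases "t = s")
        case True
        then show ?thesis using zmod.span_scale[OF D'(2), of "int D"] by (simp add: mult_ac)
      next
        case False
        then have "real D * t \<in> zmod.span B" using t D by blast
        from zmod.span_scale[OF this, of "int D'"] show ?thesis by (simp add: mult_ac)
      qed
      then show ?case using D(1) D'(1) by (intro exI[of _ "D * D'"]) auto
    qed
    then obtain D :: nat where D: "D > 0" "\<And>s. s \<in> S \<Longrightarrow> real D * s \<in> zmod.span B" by blast
    \<comment> \<open>\<open>H'\<close> is D H cut down to the span of \<open>B\<close>. It contains
      D S and has at most \<open>card B\<close> generators, so its classes modulo N are bounded;
      members of \<open>S\<close> that give the same class are congruent modulo N H after division
      by D.\<close>
    define H' where "H' = {h \<in> zmod.span B. h / real D \<in> H}"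
    have "zmod.subspace H'"
    proof (rule zmod.subspaceI)
      show "0 \<in> H'" using H by (simp add: H'_def zmod.subspace_0 zmod.span_zero)
      show "x + y \<in> H'" if "x \<in> H'" "y \<in> H'" for x y
        using that H by (simp add: H'_def zmod.span_add zmod.subspace_add add_divide_distrib)
      show "of_int c * x \<in> H'" if "x \<in> H'" for c x
        using that zmod.subspace_scale[OF H, of "x / real D" c] by (simp add: H'_def zmod.span_scale)
    qed
    then obtain B' where B': "finite B'" "card B' \<le> card B" "zmod.span B' = H'"
      using subgroup_of_finitely_generated[OF assms(1)] unfolding H'_def by blast
    obtain R where R: "finite R" "card R \<le> N ^ card B'"
      "\<And>h. h \<in> H' \<Longrightarrow> \<exists>r\<in>R. \<exists>k\<in>H'. h = r + real N * k"
      using span_finite_mod_nat[OF B'(1) assms(2)] B'(3) by auto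
    have "real D * s \<in> H'" if "s \<in> S" for s
      using D that S by (auto simp: H'_def indep_def)
    with R(3) have "\<forall>s\<in>S. \<exists>r. r \<in> R \<and> (\<exists>k\<in>H'. real D * s = r + real N * k)" by blast
    then obtain f where f: "\<And>s. s \<in> S \<Longrightarrow> f s \<in> R"
      "\<And>s. s \<in> S \<Longrightarrow> \<exists>k\<in>H'. real D * s = f s + real N * k" by metis
    have "inj_on f S"
    proof (rule inj_onI)
      fix s s' assume s: "s \<in> S" "s' \<in> S" "f s = f s'"
      obtain k k' where k: "k \<in> H'" "k' \<in> H'" "real D * s = f s + real N * k"
        "real D * s' = f s + real N * k'" using f(2) s by metis
      have "real D * (s - s') = real N * (k - k')" using k(3,4) by (simp add: algebra_simps)
      then have "s = s' + real N * (k / real D - k' / real D)" using D(1) by (simp add: field_simps)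
      moreover have "k / real D - k' / real D \<in> H"
        using k(1,2) H by (auto simp: H'_def intro: zmod.subspace_diff)
      ultimately show "s = s'" using S s unfolding indep_def by blast
    qed
    then have "card S \<le> card R" using f(1) R(1) by (intro card_inj_on_le[of f]) auto
    also have "\<dots> \<le> N ^ card B" using R(2) B'(2) assms(2) power_increasing[of "card B'" "card B" N]
      by linarith
    finally show ?thesis .
  qed
  \<comment> \<open>A largest incongruent set exists by the bound. It is a system of
    representatives, since an element congruent to none of its members could be added.\<close>
  have "indep {}" by (simp add: indep_def)
  then obtain S where S: "indep S" "\<And>T. indep T \<Longrightarrow> card T \<le> card S"
    using bound Lattices_Big.ex_has_greatest_nat[of indep "{}" card "Suc (N ^ card B)"]
    by (auto simp: less_Suc_eq_le)
  have "\<exists>r\<in>S. \<exists>k\<in>H. h = r + real N * k" if h: "h \<in> H" for h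
  proof (rule ccontr)
    assume *: "\<not> ?thesis"
    have 0: "0 \<in> H" using H zmod.subspace_0 by blast
    have "h \<notin> S" using * 0 by force
    moreover have "indep (insert h S)"
      unfolding indep_def
    proof (intro conjI ballI impI)
      fix s s' k assume s: "s \<in> insert h S" "s' \<in> insert h S" "k \<in> H" "s = s' + real N * k"
      have "s' = s + real N * (- k)" using s(4) by simp
      moreover have "- k \<in> H" using s(3) H zmod.subspace_neg by blast
      ultimately show "s = s'" using s * S(1) unfolding indep_def by blast
    qed (use S(1) h in \<open>auto simp: indep_def\<close>)
    ultimately show False using S(2)[of "insert h S"] S(1) by (simp add: indep_def)
  qed
  then show ?thesis using that[of S] S(1) by (auto simp: indep_def)
qed

section \<open>Algebraic integers form a ring\<close>

lemma power_span_imp_poly: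
  fixes x :: real
  assumes "y \<in> zmod.span ((\<lambda>i. x ^ i) ` {..<k})"
  shows "\<exists>p. (\<forall>i. coeff p i \<in> \<int>) \<and> (\<forall>i\<ge>k. coeff p i = 0) \<and> poly p x = y"
  using assms
proof (induction rule: zmod.span_induct_alt)
  case base
  then show ?case by (intro exI[of _ 0]) simp
next
  case (step c u v)
  then obtain i p where ip: "i < k" "u = x ^ i" "\<forall>i. coeff p i \<in> \<int>" "\<forall>i\<ge>k. coeff p i = 0"
    "poly p x = v" by blast
  then show ?case
    by (intro exI[of _ "monom (of_int c) i + p"]) (auto simp: poly_monom)
qed

text \<open>One direction reduces powers by the monic equation. For the other, \<int>[x] is finitely
  generated, being a subgroup of a finitely generated group; its generators involve only powers
  below some k, so x^k is an integral combination of lower powers.\<close>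

lemma algebraic_int_iff_powers_in_span:
  fixes x :: real
  shows "algebraic_int x \<longleftrightarrow> (\<exists>B. finite B \<and> (\<forall>n. x ^ n \<in> zmod.span B))"
proof
  assume "algebraic_int x"
  then obtain p :: "real poly" where p: "lead_coeff p = 1" "\<And>i. coeff p i \<in> \<int>" "poly p x = 0"
    by (auto elim: algebraic_int.cases)
  define d where "d = degree p"
  define B where "B = (\<lambda>i. x ^ i) ` {..<d}"
  have "x ^ n \<in> zmod.span B" for n
  proof (induction n rule: less_induct)
    case (less n)
    show ?case
    proof (cases "n < d")
      case True
      then show ?thesis by (auto simp: B_def intro: zmod.span_base)
    next
      case False
      have "0 = (\<Sum>i<Suc d. coeff p i * x ^ i)"
        using p(3) by (simp add: poly_altdef d_def lessThan_Suc_atMost)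
      then have "x ^ d = - (\<Sum>i<d. coeff p i * x ^ i)" using p(1) by (simp add: d_def)
      then have "x ^ n = - (\<Sum>i<d. coeff p i * x ^ i) * x ^ (n - d)"
        using False power_add[of x d "n - d"] by simp
      also have "\<dots> = - (\<Sum>i<d. coeff p i * x ^ (i + (n - d)))"
        by (simp add: sum_distrib_right power_add mult.assoc)
      also have "\<dots> \<in> zmod.span B"
      proof (intro zmod.span_neg zmod.span_sum)
        fix i assume "i \<in> {..<d}"
        then have "x ^ (i + (n - d)) \<in> zmod.span B" using False by (intro less) auto
        moreover obtain c where "coeff p i = of_int c" using p(2) Ints_cases by metis
        ultimately show "coeff p i * x ^ (i + (n - d)) \<in> zmod.span B"
          using zmod.span_scale by metis
      qed
      finally show ?thesis .
    qed
  qed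
  then show "\<exists>B. finite B \<and> (\<forall>n. x ^ n \<in> zmod.span B)" by (intro exI[of _ B]) (simp add: B_def)
next
  assume "\<exists>B. finite B \<and> (\<forall>n. x ^ n \<in> zmod.span B)"
  then obtain B where B: "finite B" "\<And>n. x ^ n \<in> zmod.span B" by blast
  define P where "P k = (\<lambda>i. x ^ i) ` {..<k}" for k :: nat
  have mono: "zmod.span (P k) \<subseteq> zmod.span (P m)" if "k \<le> m" for k m
    using that by (intro zmod.span_mono) (auto simp: P_def)
  \<comment> \<open>\<open>B\<close> need not lie in \<int>[x], so it is first traded for generators
    \<open>B'\<close> of \<int>[x].\<close>
  have "zmod.span (range (\<lambda>i. x ^ i)) \<subseteq> zmod.span B" using B by (intro zmod.span_minimal) auto
  then obtain B' where B': "finite B'" "zmod.span B' = zmod.span (range (\<lambda>i. x ^ i))"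
    using subgroup_of_finitely_generated[OF B(1) zmod.subspace_span] by blast
  have bounded: "\<exists>k. y \<in> zmod.span (P k)" if "y \<in> zmod.span (range (\<lambda>i. x ^ i))" for y
    using that
  proof (induction rule: zmod.span_induct_alt)
    case base
    then show ?case using zmod.span_zero by blast
  next
    case (step c u v)
    then obtain i k where "u = x ^ i" "v \<in> zmod.span (P k)" by blast
    moreover have "x ^ i \<in> zmod.span (P (Suc i))" by (auto simp: P_def intro: zmod.span_base)
    ultimately have "of_int c * u + v \<in> zmod.span (P (max k (Suc i)))"
      using mono[of k "max k (Suc i)"] mono[of "Suc i" "max k (Suc i)"]
      by (intro zmod.span_add zmod.span_scale) auto
    then show ?case by blast
  qed
  have "\<exists>k. B' \<subseteq> zmod.span (P k)"
  proof -
    have "B' \<subseteq> zmod.span (range (\<lambda>i. x ^ i))" using B'(2) zmod.span_superset by blast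
    with B'(1) show ?thesis
    proof (induction B' rule: finite_induct)
      case (insert b B')
      then obtain k m where "b \<in> zmod.span (P k)" "B' \<subseteq> zmod.span (P m)" using bounded by blast
      then show ?case using mono[of k "max k m"] mono[of m "max k m"]
        by (intro exI[of _ "max k m"]) auto
    qed simp
  qed
  then obtain k where "B' \<subseteq> zmod.span (P k)" by blast
  then have "zmod.span B' \<subseteq> zmod.span (P k)" by (intro zmod.span_minimal) auto
  moreover have "x ^ k \<in> zmod.span B'" using B'(2) by (auto intro: zmod.span_base)
  ultimately obtain p where p: "\<And>i. coeff p i \<in> \<int>" "\<And>i. i \<ge> k \<Longrightarrow> coeff p i = 0" "poly p x = x ^ k"
    using power_span_imp_poly[of "x ^ k" x k] unfolding P_def by blast
  have deg: "degree (monom 1 k - p) = k"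
    by (rule antisym, rule degree_le) (auto simp: p(2) intro: le_degree)
  show "algebraic_int x"
  proof (rule algebraic_int.intros)
    show "lead_coeff (monom 1 k - p) = 1" unfolding deg by (simp add: p(2))
    show "\<forall>i. coeff (monom 1 k - p) i \<in> \<int>" using p(1) by auto
    show "poly (monom 1 k - p) x = 0" by (simp add: p(3) poly_monom)
  qed
qed

lemma span_times:
  assumes "x \<in> zmod.span B" "y \<in> zmod.span C"
  shows "x * y \<in> zmod.span ((\<lambda>(b, c). b * c) ` (B \<times> C))" (is "_ \<in> zmod.span ?P")
proof -
  have *: "b * y \<in> zmod.span ?P" if b: "b \<in> B" for b
    using assms(2)
  proof (induction rule: zmod.span_induct_alt)
    case (step k u v)
    have "b * u \<in> zmod.span ?P" using b step by (intro zmod.span_base) force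
    then have "of_int k * (b * u) + b * v \<in> zmod.span ?P"
      using step by (intro zmod.span_add zmod.span_scale)
    then show ?case by (simp add: algebra_simps)
  qed (simp add: zmod.span_zero)
  show ?thesis
    using assms(1)
  proof (induction rule: zmod.span_induct_alt)
    case (step k u v)
    then have "of_int k * (u * y) + v * y \<in> zmod.span ?P"
      by (simp add: zmod.span_add zmod.span_scale *)
    then show ?case by (simp add: algebra_simps)
  qed (simp add: zmod.span_zero)
qed

text \<open>The products of the two generating sets generate a group containing every
  \<open>x ^ i * y ^ j\<close>, hence all powers of the sum and of the product.\<close>

lemma algebraic_int_add_mult_real:
  fixes x y :: real
  assumes "algebraic_int x" "algebraic_int y"
  shows "algebraic_int (x + y)" and "algebraic_int (x * y)"
proof -
  obtain B C where B: "finite B" "\<And>n. x ^ n \<in> zmod.span B"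
    and C: "finite C" "\<And>n. y ^ n \<in> zmod.span C"
    using assms unfolding algebraic_int_iff_powers_in_span by blast
  let ?P = "(\<lambda>(b, c). b * c) ` (B \<times> C)"
  have xy: "x ^ i * y ^ j \<in> zmod.span ?P" for i j using span_times[OF B(2) C(2)] .
  have "(x + y) ^ n \<in> zmod.span ?P" for n
    unfolding binomial_ring
  proof (rule zmod.span_sum)
    fix k
    show "of_nat (n choose k) * x ^ k * y ^ (n - k) \<in> zmod.span ?P"
      using zmod.span_scale[OF xy[of k "n - k"], of "int (n choose k)"] by (simp add: mult_ac)
  qed
  moreover have "finite ?P" using B(1) C(1) by simp
  ultimately show "algebraic_int (x + y)" "algebraic_int (x * y)"
    unfolding algebraic_int_iff_powers_in_span power_mult_distrib using xy by metis+
qed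

section \<open>The trace field of a Salem number\<close>

abbreviation rpoly :: "rat poly \<Rightarrow> 'a::field_char_0 \<Rightarrow> 'a" where
  "rpoly q x \<equiv> poly (map_poly of_rat q) x"

lemma rpoly_pCons: "rpoly (pCons a q) x = of_rat a + x * rpoly q x"
  by (simp add: map_poly_pCons)

lemma rpoly_add: "rpoly (p + q) x = rpoly p x + rpoly q x"
proof -
  have "map_poly of_rat (p + q) = map_poly of_rat p + (map_poly of_rat q :: 'a poly)"
    by (rule poly_eqI) (simp add: coeff_map_poly of_rat_add)
  then show ?thesis by simp
qed

lemma rpoly_smult: "rpoly (smult c q) x = of_rat c * rpoly q x"
  by (simp add: map_poly_smult of_rat_mult)

lemma rpoly_mult: "rpoly (p * q) x = rpoly p x * rpoly q x"
  by (induction p) (simp_all add: rpoly_add rpoly_smult rpoly_pCons algebra_simps)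

lemma rpoly_of_real: "rpoly q (of_real x :: 'a::{field_char_0, real_field}) = of_real (rpoly q x)"
proof -
  have rat: "of_rat r = (of_real (of_rat r) :: 'a)" for r
    by (cases r) (simp add: of_rat_rat)
  show ?thesis by (induction q) (simp_all add: rpoly_pCons flip: rat)
qed

lemma rpoly_map_of_int: "rpoly (map_poly of_int p) x = poly (map_poly of_int p) x"
  by (simp add: map_poly_map_poly o_def)

lemma field_embedding_of_rat:
  assumes K: "real_subfield K" and s: "field_embedding K \<sigma>"
  shows "of_rat r \<in> K" and "\<sigma> (of_rat r) = (of_rat r :: 'a::field_char_0)"
proof -
  have [simp]: "0 \<in> K" "1 \<in> K" "\<sigma> 1 = 1" using K s by (auto simp: real_subfield_def field_embedding_def)
  have clos: "x + y \<in> K" "x * y \<in> K" "- x \<in> K" "inverse x \<in> K" if "x \<in> K" "y \<in> K" for x y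
    using K that by (auto simp: real_subfield_def)
  have hom: "\<sigma> (x + y) = \<sigma> x + \<sigma> y" "\<sigma> (x * y) = \<sigma> x * \<sigma> y" if "x \<in> K" "y \<in> K" for x y
    using s that by (auto simp: field_embedding_def)
  have [simp]: "\<sigma> 0 = 0" using hom(1)[of 0 0] by simp
  have nat: "of_nat n \<in> K \<and> \<sigma> (of_nat n) = of_nat n" for n
    by (induction n) (simp_all add: clos hom)
  have neg: "\<sigma> (- x) = - \<sigma> x" if "x \<in> K" for x
    using hom(1)[of x "- x"] that clos[of x x] by (simp add: add_eq_0_iff)
  have int: "of_int i \<in> K \<and> \<sigma> (of_int i) = of_int i" for i
    by (cases i rule: int_cases2) (use nat neg clos(3)[OF conjunct1[OF nat] conjunct1[OF nat]] in auto)
  obtain a b where ab: "r = Rat.Fract a b" "b > 0" by (cases r) auto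
  have r: "of_rat r = (of_int a * inverse (of_int b) :: real)"
    using ab by (simp add: of_rat_rat divide_inverse)
  show mem: "of_rat r \<in> K" unfolding r using int[of a] int[of b] clos(2) clos(4)[of "of_int b" 1] by simp
  have "of_int b * of_rat r = (of_int a :: real)" using r ab by simp
  then have "of_int b * \<sigma> (of_rat r) = of_int a" using hom(2)[of "of_int b" "of_rat r"] int mem by metis
  then show "\<sigma> (of_rat r) = of_rat r" using ab by (simp add: of_rat_rat field_simps)
qed

lemma field_embedding_rpoly:
  assumes K: "real_subfield K" and s: "field_embedding K \<sigma>" and x: "x \<in> K"
  shows "rpoly q x \<in> K" and "\<sigma> (rpoly q x) = (rpoly q (\<sigma> x) :: 'a::field_char_0)"
proof -
  have "rpoly q x \<in> K \<and> \<sigma> (rpoly q x) = rpoly q (\<sigma> x)"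
  proof (induction q)
    case 0
    then show ?case using field_embedding_of_rat[OF K s, of 0] by simp
  next
    case (pCons a q)
    then show ?case unfolding rpoly_pCons using K s x field_embedding_of_rat[OF K s, of a]
      by (auto simp: real_subfield_def field_embedding_def)
  qed
  then show "rpoly q x \<in> K" "\<sigma> (rpoly q x) = rpoly q (\<sigma> x)" by auto
qed

text \<open>Let \<open>m\<close> have least degree among the nonzero polynomials vanishing at
  \<open>x\<close>. The gcd of \<open>m\<close> and \<open>q\<close> divides \<open>q\<close>, so it
  does not vanish at \<open>x\<close>; its cofactor in \<open>m\<close> then does, and minimality
  makes the gcd constant. Bezout inverts \<open>q\<close> modulo \<open>m\<close>.\<close>

lemma rpoly_inverse:
  fixes x :: real
  assumes "algebraic_int x" "rpoly q x \<noteq> 0"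
  shows "\<exists>r. inverse (rpoly q x) = rpoly r x"
proof -
  obtain p :: "int poly" where p: "poly (map_poly of_int p) x = 0" "lead_coeff p = 1"
    using assms(1) algebraic_int_altdef_ipoly by blast
  define Z where "Z = (\<lambda>m::rat poly. m \<noteq> 0 \<and> rpoly m x = 0)"
  have "Z (map_poly of_int p)"
    using p by (auto simp: Z_def rpoly_map_of_int map_poly_eq_0_iff)
  then obtain m where m: "Z m" "\<And>m'. Z m' \<Longrightarrow> degree m \<le> degree m'"
    using ex_has_least_nat[of Z _ degree] by blast
  define g where "g = gcd m q"
  obtain h where h: "m = g * h" unfolding g_def by (meson dvdE gcd_dvd1)
  obtain k where k: "q = g * k" unfolding g_def by (meson dvdE gcd_dvd2)
  have "rpoly g x \<noteq> 0" using assms(2) k rpoly_mult[of g k x] by auto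
  then have "rpoly h x = 0" using m(1) h by (simp add: Z_def rpoly_mult)
  moreover have nz: "g \<noteq> 0" "h \<noteq> 0" using m(1) h by (auto simp: Z_def)
  ultimately have "degree m \<le> degree h" using m(2) by (simp add: Z_def)
  then have "degree g = 0" using nz h by (simp add: degree_mult_eq)
  then obtain c where c: "g = [:c:]" by (rule degree_eq_zeroE)
  then have "c \<noteq> 0" using nz by simp
  obtain u v where uv: "u * m + v * q = g"
    using that[OF bezout_coefficients_fst_snd[of m q, folded g_def]] .
  have "rpoly v x * rpoly q x = rpoly g x"
    using m(1) unfolding uv[symmetric] by (simp add: Z_def rpoly_add rpoly_mult)
  also have "\<dots> = of_rat c" by (simp add: c rpoly_pCons)
  finally have "inverse (rpoly q x) = rpoly (smult (inverse c) v) x"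
    unfolding rpoly_smult of_rat_inverse using \<open>c \<noteq> 0\<close> assms(2) by (simp add: field_simps)
  then show ?thesis by blast
qed

lemma real_subfield_rat_adjoin: "real_subfield (rat_adjoin a)"
  by (auto simp: real_subfield_def rat_adjoin_def)

lemma mem_rat_adjoin: "a \<in> rat_adjoin a"
  by (auto simp: rat_adjoin_def)

text \<open>As polynomial expressions in \<open>a\<close> are closed under inverses, they already
  form a field. Hence an embedding is determined by the image of \<open>a\<close>.\<close>

lemma rat_adjoin_eq_range:
  assumes "algebraic_int a"
  shows "rat_adjoin a = range (\<lambda>q. rpoly q a)"
proof
  have "real_subfield (range (\<lambda>q. rpoly q a))"
    unfolding real_subfield_def
  proof (intro conjI ballI)
    show "0 \<in> range (\<lambda>q. rpoly q a)" by (rule range_eqI[of _ _ 0]) simp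
    show "1 \<in> range (\<lambda>q. rpoly q a)" by (rule range_eqI[of _ _ 1]) simp
    fix x assume "x \<in> range (\<lambda>q. rpoly q a)"
    then obtain p where p: "x = rpoly p a" by blast
    have "- x = rpoly (smult (- 1) p) a" unfolding rpoly_smult p by (simp add: of_rat_minus)
    then show "- x \<in> range (\<lambda>q. rpoly q a)" by blast
    show "inverse x \<in> range (\<lambda>q. rpoly q a)"
    proof (cases "x = 0")
      case True
      then show ?thesis by (intro range_eqI[of _ _ 0]) simp
    qed (use rpoly_inverse[OF assms, of p] p in auto)
    fix y assume "y \<in> range (\<lambda>q. rpoly q a)"
    then obtain q where q: "y = rpoly q a" by blast
    show "x + y \<in> range (\<lambda>q. rpoly q a)" unfolding p q rpoly_add[symmetric] by blast
    show "x * y \<in> range (\<lambda>q. rpoly q a)" unfolding p q rpoly_mult[symmetric] by blast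
  qed
  moreover have "a \<in> range (\<lambda>q. rpoly q a)"
    by (rule range_eqI[of _ _ "[:0, 1:]"]) (simp add: rpoly_pCons)
  ultimately show "rat_adjoin a \<subseteq> range (\<lambda>q. rpoly q a)" unfolding rat_adjoin_def by blast
  have "field_embedding (rat_adjoin a) (\<lambda>x. x)" by (simp add: field_embedding_def)
  then show "range (\<lambda>q. rpoly q a) \<subseteq> rat_adjoin a"
    using field_embedding_rpoly(1)[OF real_subfield_rat_adjoin _ mem_rat_adjoin] by blast
qed

lemma number_field_rat_adjoin:
  assumes "algebraic_int a" "a > 1"
  shows "number_field (rat_adjoin a)"
  unfolding number_field_def
proof (intro conjI)
  obtain p :: "int poly" where p: "poly (map_poly of_int p) a = 0" "lead_coeff p = 1"
    using assms(1) algebraic_int_altdef_ipoly by blast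
  define m where "m = (map_poly of_int p :: rat poly)"
  have m: "rpoly m a = 0" "m \<noteq> 0" using p by (auto simp: m_def rpoly_map_of_int map_poly_eq_0_iff)
  define d where "d = degree m"
  define B where "B = (\<lambda>i. a ^ i) ` {..<d}"
  \<comment> \<open>Since \<open>a > 1\<close> its powers are distinct, so a coefficient can be
    attached to the number a^i in place of the exponent i.\<close>
  have inj: "inj_on (\<lambda>i. a ^ i) {..<d}" using assms(2) by (auto intro!: inj_onI)
  have "a ^ i \<in> rat_adjoin a" for i
    by (induction i) (use real_subfield_rat_adjoin[of a] mem_rat_adjoin[of a] in \<open>auto simp: real_subfield_def\<close>)
  then have "B \<subseteq> rat_adjoin a" by (auto simp: B_def)
  moreover have "\<exists>c::real \<Rightarrow> rat. x = (\<Sum>b\<in>B. of_rat (c b) * b)" if x: "x \<in> rat_adjoin a" for x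
  proof -
    obtain q where q: "x = rpoly q a" using x rat_adjoin_eq_range[OF assms(1)] by blast
    have "q = q div m * m + q mod m" by simp
    then have x: "x = rpoly (q mod m) a" using q m(1) by (metis add_0 mult_zero_right rpoly_add rpoly_mult)
    have deg: "q mod m = 0 \<or> degree (q mod m) < d" unfolding d_def using m(2) degree_mod_less by blast
    have "rpoly (q mod m) a = (\<Sum>i<d. of_rat (coeff (q mod m) i) * a ^ i)"
    proof (cases "q mod m = 0")
      case False
      then have "degree (q mod m) < d" using deg by blast
      then show ?thesis unfolding poly_altdef
        by (intro sum.mono_neutral_cong_left) (auto simp: coeff_map_poly degree_map_poly coeff_eq_0)
    qed simp
    also have "\<dots> = (\<Sum>b\<in>B. of_rat (coeff (q mod m) (inv_into {..<d} (\<lambda>i. a ^ i) b)) * b)"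
      unfolding B_def by (subst sum.reindex[OF inj]) (auto simp: inv_into_f_f[OF inj] intro!: sum.cong)
    finally show ?thesis using x by (intro exI[of _ "\<lambda>b. coeff (q mod m) (inv_into {..<d} (\<lambda>i. a ^ i) b)"]) simp
  qed
  ultimately show "\<exists>B. finite B \<and> B \<subseteq> rat_adjoin a \<and>
      (\<forall>x\<in>rat_adjoin a. \<exists>c::real \<Rightarrow> rat. x = (\<Sum>b\<in>B. of_rat (c b) * b))"
    by (intro exI[of _ B]) (simp add: B_def)
qed (rule real_subfield_rat_adjoin)

text \<open>Reduction modulo x^2 - y x + 1 with \<open>y\<close> as a parameter. The same
  \<open>a\<close> and \<open>b\<close> serve all pairs (x, y), so what is learnt at the Salem
  number can be moved to the image of the trace under an embedding.\<close>

lemma rpoly_reduce_quadratic: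
  fixes p :: "rat poly"
  obtains a b where
    "\<And>x y :: complex. x\<^sup>2 = y * x - 1 \<Longrightarrow> rpoly p x = rpoly a y + rpoly b y * x"
proof -
  have "\<exists>a b. \<forall>x y :: complex. x\<^sup>2 = y * x - 1 \<longrightarrow> rpoly p x = rpoly a y + rpoly b y * x"
  proof (induction p)
    case 0
    then show ?case by (intro exI[of _ 0]) simp
  next
    case (pCons c p)
    then obtain a b where ab:
      "\<And>x y :: complex. x\<^sup>2 = y * x - 1 \<Longrightarrow> rpoly p x = rpoly a y + rpoly b y * x" by blast
    have "rpoly (pCons c p) x = rpoly ([:c:] + smult (- 1) b) y + rpoly (a + pCons 0 b) y * x"
      if xy: "x\<^sup>2 = y * x - 1" for x y :: complex
    proof -
      have "rpoly b y * (x * x) = rpoly b y * (y * x - 1)" using xy by (simp add: power2_eq_square)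
      then show ?thesis unfolding rpoly_pCons rpoly_add rpoly_smult ab[OF xy]
        by (simp add: of_rat_minus algebra_simps)
    qed
    then show ?case by blast
  qed
  then show ?thesis using that by blast
qed

text \<open>The irreducible \<open>p\<close> shares the root \<open>l\<close> with a monic integral
  polynomial and therefore divides it, so its other root 1/l satisfies the same monic
  equation.\<close>

lemma salem_inverse_algebraic_int:
  assumes "salem_number l"
  shows "algebraic_int (inverse l)"
proof -
  obtain p where p: "irreducible p" "rpoly p (of_real l :: complex) = 0"
    "rpoly p (of_real (inverse l) :: complex) = 0"
    using assms unfolding salem_number_def conjugate_over_rat_def by blast
  obtain q :: "int poly" where q: "poly (map_poly of_int q) l = 0" "lead_coeff q = 1"
    using assms algebraic_int_altdef_ipoly unfolding salem_number_def by blast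
  define Q where "Q = (map_poly of_int q :: rat poly)"
  have Ql: "rpoly Q l = 0" using q by (simp add: Q_def rpoly_map_of_int)
  have pl: "rpoly p l = 0" "rpoly p (inverse l) = 0" using p(2,3) unfolding rpoly_of_real by simp_all
  have "p dvd Q"
  proof (rule ccontr)
    assume "\<not> p dvd Q"
    then have "gcd p Q = 1"
      using p(1) irreducible_imp_prime_elem prime_elem_imp_coprime by (metis coprime_imp_gcd_eq_1)
    then obtain u v where "u * p + v * Q = 1"
      using bezout_coefficients_fst_snd[of p Q] by auto
    then have "rpoly (u * p + v * Q) l = 1" by simp
    then show False unfolding rpoly_add rpoly_mult by (simp add: Ql pl)
  qed
  then have "rpoly Q (inverse l) = 0" using pl(2) by (auto simp: rpoly_mult elim!: dvdE)
  then show ?thesis unfolding algebraic_int_altdef_ipoly Q_def rpoly_map_of_int using q(2) by blast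
qed

text \<open>An embedding \<open>\<sigma>\<close> of the trace field is lifted by choosing \<open>z\<close> with \<open>z + 1/z = \<sigma> (l + 1/l)\<close>:
  the minimal polynomial of \<open>l\<close> modulo \<open>x\<^sup>2 - y x + 1\<close> has coefficients vanishing at
  \<open>y = l + 1/l\<close>, hence at \<open>\<sigma> y\<close>, so that \<open>z\<close> is a conjugate of \<open>l\<close>.\<close>

lemma salem_trace_embedding:
  fixes \<sigma> :: "real \<Rightarrow> complex"
  assumes l: "salem_number l" and s: "field_embedding (rat_adjoin (l + inverse l)) \<sigma>"
  obtains t where "\<sigma> (l + inverse l) = of_real t" "t = l + inverse l \<or> \<bar>t\<bar> \<le> 2"
proof -
  obtain p where p: "irreducible p" "rpoly p (of_real l :: complex) = 0"
    "rpoly p (of_real (inverse l) :: complex) = 0"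
    using l unfolding salem_number_def conjugate_over_rat_def by blast
  have l1: "l > 1" using l by (simp add: salem_number_def)
  define y where "y = l + inverse l"
  obtain a b where ab:
    "\<And>x y :: complex. x\<^sup>2 = y * x - 1 \<Longrightarrow> rpoly p x = rpoly a y + rpoly b y * x"
    using rpoly_reduce_quadratic[of p] by blast
  have quad: "(of_real x :: complex)\<^sup>2 = of_real y * of_real x - 1" if "x = l \<or> x = inverse l" for x
  proof -
    have "x\<^sup>2 = y * x - 1" using that l1 by (auto simp: y_def power2_eq_square algebra_simps)
    then show ?thesis by (metis of_real_1 of_real_diff of_real_mult of_real_power)
  qed
  \<comment> \<open>The conjugacy of 1/l is used here: an expression linear in x that vanishes at
    the distinct points l and 1/l has both coefficients zero.\<close>
  have "rpoly a y + rpoly b y * x = 0" if "x = l \<or> x = inverse l" for x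
  proof -
    have "rpoly p (of_real x :: complex) = 0" using that p(2,3) by blast
    then have "of_real (rpoly a y + rpoly b y * x) = (0::complex)"
      using ab[OF quad[OF that]] by (simp add: rpoly_of_real)
    then show ?thesis by (simp only: of_real_eq_0_iff)
  qed
  then have e: "rpoly a y + rpoly b y * l = 0" "rpoly a y + rpoly b y * inverse l = 0" by blast+
  then have "rpoly b y * (l - inverse l) = 0" unfolding right_diff_distrib by linarith
  moreover have "inverse l < 1" using l1 by (simp add: inverse_less_1_iff)
  ultimately have b0: "rpoly b y = 0" using l1 by simp
  then have a0: "rpoly a y = 0" using e by simp
  define u where "u = \<sigma> y"
  note emb = field_embedding_rpoly(2)[OF real_subfield_rat_adjoin s mem_rat_adjoin, folded y_def]
  have "\<sigma> 0 = 0" using field_embedding_of_rat(2)[OF real_subfield_rat_adjoin s, of 0] by simp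
  then have ab0: "rpoly a u = 0" "rpoly b u = 0" using emb[of a] emb[of b] a0 b0 by (simp_all add: u_def)
  \<comment> \<open>A root of z^2 - u z + 1. The other root is 1/z, so u = z + 1/z, which is 2 Re z
    on the unit circle.\<close>
  define z where "z = (u + csqrt (u\<^sup>2 - 4)) / 2"
  have "(2 * z - u)\<^sup>2 = u\<^sup>2 - 4" by (simp add: z_def)
  then have "4 * z\<^sup>2 = 4 * (u * z - 1)" by (simp add: power2_eq_square algebra_simps)
  then have zz: "z\<^sup>2 = u * z - 1" by (subst (asm) mult_cancel_left) simp
  then have z0: "z \<noteq> 0" by auto
  then have u: "u = z + inverse z" using zz by (simp add: field_simps power2_eq_square)
  have "rpoly p z = 0" using ab[OF zz] ab0 by simp
  then have conj: "conjugate_over_rat (of_real l) z" using p unfolding conjugate_over_rat_def by blast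
  show ?thesis
  proof (cases "z = of_real l \<or> z = of_real (inverse l)")
    case True
    then have "u = of_real y" using u by (auto simp: y_def)
    then show ?thesis using that[of y] by (simp add: u_def y_def)
  next
    case False
    then have n: "cmod z = 1" using l conj unfolding salem_number_def by blast
    then have "inverse z = cnj z" by (simp add: inverse_complex_def complex_eq_iff cmod_def)
    then have "u = of_real (2 * Re z)" using u by (simp add: complex_add_cnj)
    moreover have "\<bar>2 * Re z\<bar> \<le> 2" using abs_Re_le_cmod[of z] n by simp
    ultimately show ?thesis using that[of "2 * Re z"] by (simp add: u_def y_def)
  qed
qed

section \<open>Total reality of the trace field and its nonidentity embeddings\<close>

lemma salem_trace_gt_2:
  assumes "salem_number l"
  shows "l + inverse l > 2"
proof -
  have l: "l > 1" using assms by (simp add: salem_number_def)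
  then have "l * (l + inverse l - 2) = (l - 1)\<^sup>2" by (simp add: power2_eq_square algebra_simps)
  moreover have "(l - 1)\<^sup>2 > 0" "l > 0" using l by simp_all
  ultimately have "l + inverse l - 2 > 0" using zero_less_mult_pos[of l] by metis
  then show ?thesis by simp
qed

lemma algebraic_int_salem_trace: "salem_number l \<Longrightarrow> algebraic_int (l + inverse l)"
  using algebraic_int_add_mult_real(1) salem_inverse_algebraic_int by (auto simp: salem_number_def)

lemma salem_trace_field_totally_real:
  assumes "salem_number l"
  shows "totally_real_number_field (rat_adjoin (l + inverse l))"
  unfolding totally_real_number_field_def
proof (intro conjI allI impI)
  let ?y = "l + inverse l"
  show "number_field (rat_adjoin ?y)"
    using number_field_rat_adjoin algebraic_int_salem_trace[OF assms] salem_trace_gt_2[OF assms] by simp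
  fix \<sigma> :: "real \<Rightarrow> complex" assume s: "field_embedding (rat_adjoin ?y) \<sigma>"
  obtain t where t: "\<sigma> ?y = of_real t" using salem_trace_embedding[OF assms s] by blast
  have "\<sigma> x \<in> \<real>" if "x \<in> rat_adjoin ?y" for x
  proof -
    obtain q where q: "x = rpoly q ?y"
      using \<open>x \<in> _\<close> rat_adjoin_eq_range[OF algebraic_int_salem_trace[OF assms]] by blast
    show ?thesis
      unfolding q field_embedding_rpoly(2)[OF real_subfield_rat_adjoin s mem_rat_adjoin] t rpoly_of_real
      by simp
  qed
  then show "\<sigma> ` rat_adjoin ?y \<subseteq> \<real>" by blast
qed

text \<open>The value y itself is excluded because \<sigma> would be the identity, and the values 2
  and -2 because y - 2 and y + 2 are invertible in the field, so that no embedding sends them to 0.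
  Strictness is what makes the conjugate forms definite.\<close>

lemma salem_trace_nonidentity_embedding:
  fixes \<sigma> :: "real \<Rightarrow> real"
  assumes l: "salem_number l" and s: "field_embedding (rat_adjoin (l + inverse l)) \<sigma>"
    and x: "x \<in> rat_adjoin (l + inverse l)" "\<sigma> x \<noteq> x"
  shows "\<bar>\<sigma> (l + inverse l)\<bar> < 2"
proof -
  let ?y = "l + inverse l"
  note alg = algebraic_int_salem_trace[OF l]
  have y2: "?y > 2" using salem_trace_gt_2[OF l] .
  have "field_embedding (rat_adjoin ?y) (\<lambda>x. complex_of_real (\<sigma> x))"
    using s unfolding field_embedding_def by simp
  then obtain t where t: "complex_of_real (\<sigma> ?y) = of_real t" "t = ?y \<or> \<bar>t\<bar> \<le> 2"
    using salem_trace_embedding[OF l] by blast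
  obtain q where "x = rpoly q ?y" using x rat_adjoin_eq_range[OF alg] by blast
  then have "\<sigma> ?y \<noteq> ?y"
    using x(2) field_embedding_rpoly(2)[OF real_subfield_rat_adjoin s mem_rat_adjoin, of q] by auto
  then have le: "\<bar>\<sigma> ?y\<bar> \<le> 2" using t by auto
  have "\<sigma> ?y \<noteq> of_rat r" if r: "\<bar>r\<bar> = 2" for r
  proof
    assume eq: "\<sigma> ?y = of_rat r"
    have "r = 2 \<or> r = - 2" using r by linarith
    then have "real_of_rat r = 2 \<or> real_of_rat r = - 2" by (auto simp: of_rat_minus)
    then have nz: "rpoly [:- r, 1:] ?y \<noteq> 0" using y2 by (auto simp: rpoly_pCons of_rat_minus)
    then obtain s' where s': "inverse (rpoly [:- r, 1:] ?y) = rpoly s' ?y"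
      using rpoly_inverse[OF alg] by blast
    have "rpoly ([:- r, 1:] * s') ?y = 1" unfolding rpoly_mult s'[symmetric] using nz by simp
    then have "rpoly ([:- r, 1:] * s') (\<sigma> ?y) = \<sigma> 1"
      using field_embedding_rpoly(2)[OF real_subfield_rat_adjoin s mem_rat_adjoin] by metis
    then show False using s unfolding rpoly_mult by (simp add: eq rpoly_pCons of_rat_minus field_embedding_def)
  qed
  from this[of 2] this[of "- 2"] have "\<sigma> ?y \<noteq> 2" "\<sigma> ?y \<noteq> - 2" by (simp_all add: of_rat_minus)
  then show ?thesis using le by linarith
qed

section \<open>Quadratic forms and the light cone\<close>

lemma matrix_inv_inverse:
  assumes "invertible A"
  shows "A ** matrix_inv A = mat 1" "matrix_inv A ** A = mat 1"
proof -
  have "A ** matrix_inv A = mat 1 \<and> matrix_inv A ** A = mat 1"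
    using assms unfolding invertible_def matrix_inv_def by (rule someI_ex)
  then show "A ** matrix_inv A = mat 1" "matrix_inv A ** A = mat 1" by auto
qed

lemma matrix_inv_eqI:
  fixes A :: "real^'m::finite^'m"
  assumes "A ** B = mat 1"
  shows "invertible A" "matrix_inv A = B"
proof -
  have BA: "B ** A = mat 1" using assms matrix_left_right_inverse by blast
  then show inv: "invertible A" using assms unfolding invertible_def by blast
  have "matrix_inv A = matrix_inv A ** (A ** B)" using assms by simp
  also have "\<dots> = B" unfolding matrix_mul_assoc matrix_inv_inverse[OF inv] by simp
  finally show "matrix_inv A = B" .
qed

lemma qform_congruence:
  fixes A :: "real^'m::finite^'m"
  shows "qform A (T *v x) = qform (transpose T ** A ** T) x"
proof -
  have "qform (transpose T ** A ** T) x = x \<bullet> (transpose T *v (A *v (T *v x)))"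
    by (simp add: qform_def matrix_vector_mul_assoc matrix_mul_assoc)
  also have "\<dots> = (x v* transpose T) \<bullet> (A *v (T *v x))" by (rule dot_lmul_matrix[symmetric])
  finally show ?thesis by (simp add: qform_def)
qed

lemma symmetric_matrix_eqI:
  fixes A B :: "real^'m::finite^'m"
  assumes "transpose A = A" "transpose B = B" "\<And>x. qform A x = qform B x"
  shows "A = B"
proof -
  have pol: "qform C (x + y) = qform C x + qform C y + 2 * (x \<bullet> (C *v y))"
    if C: "transpose C = C" for C :: "real^'m^'m" and x y
  proof -
    have "y \<bullet> (C *v x) = (C *v y) \<bullet> x" using dot_lmul_matrix[of y C x] transpose_matrix_vector[of C y] C by simp
    then show ?thesis by (simp add: qform_def matrix_vector_right_distrib inner_add inner_commute)
  qed
  have "x \<bullet> (A *v y) = x \<bullet> (B *v y)" for x y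
    using pol[OF assms(1), of x y] pol[OF assms(2), of x y] assms(3) by simp
  then have "A *v y = B *v y" for y by (metis vector_eq_ldot)
  then show ?thesis by (simp add: matrix_eq)
qed

lemma preserves_qform_iff:
  fixes A T :: "real^'m::finite^'m"
  assumes "transpose A = A"
  shows "transpose T ** A ** T = A \<longleftrightarrow> (\<forall>x. qform A (T *v x) = qform A x)"
proof
  have sym: "transpose (transpose T ** A ** T) = transpose T ** A ** T"
    by (simp only: matrix_transpose_mul transpose_transpose assms matrix_mul_assoc)
  assume "\<forall>x. qform A (T *v x) = qform A x"
  then have "qform (transpose T ** A ** T) x = qform A x" for x unfolding qform_congruence by blast
  then show "transpose T ** A ** T = A" using symmetric_matrix_eqI[OF sym assms] by blast
qed (unfold qform_congruence, simp)

text \<open>The bridge between two ways of fixing the time direction: it consists of the positive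
  multiples of points of \<open>hyp_space\<close>, and it is one of the two components that
  \<open>O_prime\<close> refers to.\<close>

definition future_cone :: "(real^('n::finite option)) set" where
  "future_cone = {y. lorentz_form y < 0 \<and> y $ None > 0}"

text \<open>In this form convexity becomes the triangle inequality.\<close>

lemma future_cone_eq_norm:
  "future_cone = {y :: real^('n::finite option). norm (\<chi> i. y $ Some i :: real^'n) < y $ None}"
proof -
  have "lorentz_form y = (norm (\<chi> i. y $ Some i :: real^'n))\<^sup>2 - (y $ None)\<^sup>2" for y :: "real^('n option)"
    by (simp add: lorentz_form_def norm_vec_def L2_set_def sum_nonneg)
  moreover have "n\<^sup>2 - t\<^sup>2 < 0 \<and> t > 0 \<longleftrightarrow> n < t" if "n \<ge> 0" for n t :: real
    using that power2_less_imp_less[of n t] power_strict_mono[of n t 2] by auto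
  ultimately show ?thesis unfolding future_cone_def by simp
qed

lemma lorentz_form_scaleR: "lorentz_form (c *\<^sub>R y) = c\<^sup>2 * lorentz_form y"
  by (simp add: lorentz_form_def power_mult_distrib sum_distrib_left right_diff_distrib)

lemma lorentz_form_minus: "lorentz_form (- y) = lorentz_form y"
  by (simp add: lorentz_form_def)

lemma convex_future_cone: "convex (future_cone :: (real^('n::finite option)) set)"
  unfolding future_cone_eq_norm
proof (rule convexI)
  fix x y :: "real^('n option)" and u v :: real
  assume x: "x \<in> {y. norm (\<chi> i. y $ Some i :: real^'n) < y $ None}"
    and y: "y \<in> {y. norm (\<chi> i. y $ Some i :: real^'n) < y $ None}" and uv: "0 \<le> u" "0 \<le> v" "u + v = 1"
  have "(\<chi> i. (u *\<^sub>R x + v *\<^sub>R y) $ Some i :: real^'n) = u *\<^sub>R (\<chi> i. x $ Some i) + v *\<^sub>R (\<chi> i. y $ Some i)"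
    by (simp add: vec_eq_iff)
  then have "norm (\<chi> i. (u *\<^sub>R x + v *\<^sub>R y) $ Some i :: real^'n)
      \<le> u * norm (\<chi> i. x $ Some i :: real^'n) + v * norm (\<chi> i. y $ Some i :: real^'n)"
    using norm_triangle_ineq[of "u *\<^sub>R (\<chi> i. x $ Some i :: real^'n)" "v *\<^sub>R (\<chi> i. y $ Some i)"] uv by simp
  also have "\<dots> < u * x $ None + v * y $ None"
  proof (cases "u = 0")
    case True
    then show ?thesis using uv y by simp
  next
    case False
    then have "u * norm (\<chi> i. x $ Some i :: real^'n) < u * x $ None" using x uv by simp
    moreover have "v * norm (\<chi> i. y $ Some i :: real^'n) \<le> v * y $ None"
      using y uv by (intro mult_left_mono) auto
    ultimately show ?thesis by linarith
  qed
  finally show "u *\<^sub>R x + v *\<^sub>R y \<in> {y. norm (\<chi> i. y $ Some i :: real^'n) < y $ None}" by simp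
qed

lemma open_future_cone: "open (future_cone :: (real^('n::finite option)) set)"
  unfolding future_cone_def lorentz_form_def
  by (intro open_Collect_conj open_Collect_less continuous_intros)

lemma negative_cone_eq: "{y :: real^('n::finite option). lorentz_form y < 0} = future_cone \<union> uminus ` future_cone"
proof (intro equalityI subsetI)
  fix y :: "real^('n::finite option)" assume "y \<in> {y. lorentz_form y < 0}"
  then have y: "lorentz_form y < 0" by simp
  have "y $ None \<noteq> 0"
  proof
    assume "y $ None = 0"
    then have "lorentz_form y \<ge> 0" by (simp add: lorentz_form_def sum_nonneg)
    then show False using y by simp
  qed
  then consider "y $ None > 0" | "(- y) $ None > 0" by fastforce
  then show "y \<in> future_cone \<union> uminus ` future_cone"
  proof cases
    case 1
    then show ?thesis using y by (simp add: future_cone_def)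
  next
    case 2
    then have "- y \<in> future_cone" using y by (simp add: future_cone_def lorentz_form_minus)
    then show ?thesis by (metis UnI2 image_eqI minus_minus)
  qed
qed (auto simp: future_cone_def lorentz_form_minus)

text \<open>The negative cone is a disjoint union of two nonempty open convex sets, which must be
  its components; the linear homeomorphism \<open>M\<close> carries them along.\<close>

lemma components_negative_cone:
  fixes A M :: "real^('n::finite option)^('n option)"
  assumes M: "invertible M" and iso: "\<And>x. qform A (M *v x) = lorentz_form x"
  shows "components {x. qform A x < 0} = {(*v) M ` future_cone, (*v) M ` uminus ` future_cone}"
proof (rule components_open_unique)
  have MM: "M *v (matrix_inv M *v x) = x" "matrix_inv M *v (M *v x) = x" for x
    using matrix_inv_inverse[OF M] by (simp_all add: matrix_vector_mul_assoc)
  have inj: "inj ((*v) M)" by (metis MM(2) injI)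
  have "future_cone \<inter> uminus ` future_cone = ({} :: (real^('n option)) set)"
    by (auto simp: future_cone_def)
  then have "(*v) M ` future_cone \<inter> (*v) M ` uminus ` future_cone = {}"
    using image_Int[OF inj, of future_cone "uminus ` future_cone"] by simp
  then show "pairwise disjnt {(*v) M ` future_cone, (*v) M ` uminus ` future_cone}"
    by (auto simp: pairwise_def disjnt_def)
  have "{x. qform A x < 0} = (*v) M ` {y. lorentz_form y < 0}"
    using iso MM by (auto simp: image_iff) metis
  then show "\<Union> {(*v) M ` future_cone, (*v) M ` uminus ` future_cone} = {x. qform A x < 0}"
    by (simp add: negative_cone_eq image_Un)
  have op: "open ((*v) M ` X)" if "open X" for X
  proof -
    have "(*v) M ` X = (*v) (matrix_inv M) -` X" using MM by (auto simp: image_iff) metis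
    then show ?thesis using that
      by (simp add: open_vimage matrix_vector_mult_linear_continuous_on)
  qed
  have con: "connected ((*v) M ` X)" if "connected X" for X
    using that by (intro connected_continuous_image matrix_vector_mult_linear_continuous_on)
  have "axis None 1 \<in> (future_cone :: (real^('n option)) set)"
    by (simp add: future_cone_def lorentz_form_def axis_def)
  then have ne: "(future_cone :: (real^('n option)) set) \<noteq> {}" by blast
  have cc: "connected (future_cone :: (real^('n option)) set)" "connected (uminus ` (future_cone :: (real^('n option)) set))"
    using convex_future_cone convex_connected convex_negations by blast+
  have oo: "open (uminus ` (future_cone :: (real^('n option)) set))" using open_future_cone open_negations by blast
  fix X assume "X \<in> {(*v) M ` future_cone, (*v) M ` uminus ` future_cone}"
  then show "open X \<and> connected X \<and> X \<noteq> {}"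
    using op con cc oo open_future_cone ne by auto
qed

section \<open>Comparison of \<open>O_plus\<close> with the real group O'\<close>

lemma hyp_space_future_cone: "hyp_space = {y \<in> future_cone. lorentz_form y = -1}"
  by (auto simp: hyp_space_def future_cone_def)

text \<open>Each vector of \<open>future_cone\<close> is a positive multiple of a point of
  \<open>hyp_space\<close>, so for a linear isometry the two invariance conditions agree.\<close>

lemma O_plus_iff_future_cone:
  fixes g :: "real^('n::finite option)^('n option)"
  shows "g \<in> O_plus \<longleftrightarrow> (\<forall>x. lorentz_form (g *v x) = lorentz_form x) \<and> (*v) g ` future_cone = future_cone"
proof -
  have "(*v) g ` hyp_space = hyp_space \<longleftrightarrow> (*v) g ` future_cone = future_cone"
    if g: "\<And>x. lorentz_form (g *v x) = lorentz_form x"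
  proof
    assume h: "(*v) g ` hyp_space = hyp_space"
    have scale: "c *\<^sub>R x \<in> future_cone" if "c > 0" "x \<in> hyp_space" for c and x :: "real^('n option)"
      using that by (simp add: future_cone_def hyp_space_def lorentz_form_scaleR)
    have ex: "\<exists>c>0. \<exists>x\<in>hyp_space. y = c *\<^sub>R x" if "y \<in> future_cone" for y :: "real^('n option)"
    proof -
      let ?s = "sqrt (- lorentz_form y)"
      have s: "?s > 0" "?s\<^sup>2 = - lorentz_form y" using that by (simp_all add: future_cone_def)
      then have "(1 / ?s) *\<^sub>R y \<in> hyp_space"
        using that by (simp add: future_cone_def hyp_space_def lorentz_form_scaleR power_divide)
      moreover have "y = ?s *\<^sub>R ((1 / ?s) *\<^sub>R y)" using s by simp
      ultimately show ?thesis using s by blast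
    qed
    show "(*v) g ` future_cone = future_cone"
    proof (intro equalityI subsetI)
      fix y :: "real^('n option)" assume "y \<in> (*v) g ` future_cone"
      then obtain c x where cx: "c > 0" "x \<in> hyp_space" "y = g *v (c *\<^sub>R x)" using ex by blast
      then have "g *v x \<in> hyp_space" using h by blast
      then show "y \<in> future_cone" using scale cx by (simp add: matrix_vector_mult_scaleR)
    next
      fix y :: "real^('n option)" assume "y \<in> future_cone"
      then obtain c x where cx: "c > 0" "x \<in> hyp_space" "y = c *\<^sub>R x" using ex by blast
      then obtain z where "z \<in> hyp_space" "x = g *v z" using h by blast
      then have "y = g *v (c *\<^sub>R z)" "c *\<^sub>R z \<in> future_cone"
        using cx scale by (simp_all add: matrix_vector_mult_scaleR)
      then show "y \<in> (*v) g ` future_cone" by blast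
    qed
  next
    assume h: "(*v) g ` future_cone = future_cone"
    show "(*v) g ` hyp_space = hyp_space"
      unfolding hyp_space_future_cone
    proof (intro equalityI subsetI)
      fix y :: "real^('n option)" assume "y \<in> (*v) g ` {y \<in> future_cone. lorentz_form y = - 1}"
      then show "y \<in> {y \<in> future_cone. lorentz_form y = - 1}" using h g by auto
    next
      fix y :: "real^('n option)" assume y: "y \<in> {y \<in> future_cone. lorentz_form y = - 1}"
      then obtain x where "x \<in> future_cone" "y = g *v x" using h by blast
      then show "y \<in> (*v) g ` {y \<in> future_cone. lorentz_form y = - 1}" using y g by simp
    qed
  qed
  then show ?thesis unfolding O_plus_def by blast
qed

text \<open>The coordinate change \<open>M\<close> matches the forms and the cones. As linear maps
  commute with negation, invariance of one component gives that of the other.\<close>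

lemma O_prime_UNIV_conj_iff:
  fixes A M g :: "real^('n::finite option)^('n option)"
  assumes M: "invertible M" and A: "transpose A = A" and iso: "\<And>x. qform A (M *v x) = lorentz_form x"
    and g: "invertible g"
  shows "M ** g ** matrix_inv M \<in> O_prime A UNIV \<longleftrightarrow> g \<in> O_plus"
proof -
  let ?T = "M ** g ** matrix_inv M"
  have MM: "M *v (matrix_inv M *v x) = x" "matrix_inv M *v (M *v x) = x" for x
    using matrix_inv_inverse[OF M] by (simp_all add: matrix_vector_mul_assoc)
  have inj: "inj ((*v) M)" by (metis MM(2) injI)
  have TM: "?T *v (M *v x) = M *v (g *v x)" for x
    by (simp add: MM flip: matrix_vector_mul_assoc)
  have "?T ** (M ** matrix_inv g ** matrix_inv M) = M ** (g ** ((matrix_inv M ** M) ** matrix_inv g)) ** matrix_inv M"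
    by (simp add: matrix_mul_assoc)
  also have "\<dots> = mat 1" using matrix_inv_inverse[OF M] matrix_inv_inverse[OF g] by simp
  finally have T: "invertible ?T" by (rule matrix_inv_eqI)
  have "transpose ?T ** A ** ?T = A \<longleftrightarrow> (\<forall>x. qform A (?T *v (M *v x)) = qform A (M *v x))"
    unfolding preserves_qform_iff[OF A] by (metis MM(1))
  also have "\<dots> \<longleftrightarrow> (\<forall>x. lorentz_form (g *v x) = lorentz_form x)" unfolding TM iso ..
  finally have "transpose ?T ** A ** ?T = A \<longleftrightarrow> (\<forall>x. lorentz_form (g *v x) = lorentz_form x)" .
  moreover have "(\<forall>C\<in>components {x. qform A x < 0}. (*v) ?T ` C = C) \<longleftrightarrow> (*v) g ` future_cone = future_cone"
  proof -
    have conj: "(*v) ?T ` (*v) M ` X = (*v) M ` (*v) g ` X" for X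
      unfolding image_image TM ..
    have "(*v) M ` X = (*v) M ` Y \<longleftrightarrow> X = Y" for X Y using inj by (simp add: inj_image_eq_iff)
    moreover have "(*v) g ` uminus ` X = uminus ` (*v) g ` X" for X
      unfolding image_image by (simp add: linear_neg[OF matrix_vector_mul_linear])
    moreover have "uminus ` X = uminus ` Y \<longleftrightarrow> X = Y" for X Y :: "(real^('n option)) set"
      by (simp add: inj_image_eq_iff)
    ultimately show ?thesis unfolding components_negative_cone[OF M iso] by (simp add: conj)
  qed
  ultimately show ?thesis using T by (simp add: O_prime_def GL_over_def O_plus_iff_future_cone)
qed

section \<open>Commensurability\<close>

lemma invertible_mat_1: "invertible (mat 1 :: real^'k::finite^'k)"
  by (rule matrix_inv_eqI(1)[of _ "mat 1"]) simp

lemma matrix_add_rdistrib: "(B + C) ** A = B ** A + C ** (A :: real^'k::finite^'k)"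
  by (simp add: matrix_matrix_mult_def vec_eq_iff distrib_right sum.distrib)

text \<open>Conjugation by t sends H \<inter> t H t^-1 to t H t^-1 \<inter> t^2 H t^-2, which is the
  same group because t^2 lies in H. So t normalises D, and t^2 \<in> D closes D \<union> t D under
  products.\<close>

lemma (in group) subgroup_extend_by_square_root:
  assumes H: "subgroup H G" and t: "t \<in> carrier G" and tt: "t \<otimes> t \<in> H"
  defines "D \<equiv> {h \<in> H. inv t \<otimes> h \<otimes> t \<in> H}"
  shows "subgroup D G" and "subgroup (D \<union> (\<lambda>d. t \<otimes> d) ` D) G"
    and "\<And>d. d \<in> D \<Longrightarrow> t \<otimes> d \<otimes> inv t \<in> D"
proof -
  interpret H: subgroup H G by (rule H)
  note HC = H.mem_carrier
  have c1: "t \<otimes> (inv t \<otimes> x) = x" if "x \<in> carrier G" for x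
    by (subst m_assoc[symmetric]) (use t that in simp_all)
  have c2: "inv t \<otimes> (t \<otimes> x) = x" if "x \<in> carrier G" for x
    by (subst m_assoc[symmetric]) (use t that in simp_all)
  note cancel = c1 c2
  have DC: "d \<in> carrier G" if "d \<in> D" for d using that HC by (simp add: D_def)
  show D: "subgroup D G"
  proof (rule subgroup.intro)
    show "D \<subseteq> carrier G" using DC by blast
    show "\<one> \<in> D" using t by (simp add: D_def)
    fix x assume x: "x \<in> D"
    have "inv t \<otimes> inv x \<otimes> t = inv (inv t \<otimes> x \<otimes> t)"
      using t DC[OF x] by (simp add: inv_mult_group m_assoc)
    then show "inv x \<in> D" using x by (simp add: D_def)
    fix y assume y: "y \<in> D"
    have "inv t \<otimes> (x \<otimes> y) \<otimes> t = (inv t \<otimes> x \<otimes> t) \<otimes> (inv t \<otimes> y \<otimes> t)"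
      using t DC[OF x] DC[OF y] by (simp add: m_assoc cancel)
    then show "x \<otimes> y \<in> D" using x y by (simp add: D_def)
  qed
  note D_closed = subgroup.m_closed[OF D] subgroup.m_inv_closed[OF D] subgroup.one_closed[OF D]
  have ttD: "t \<otimes> t \<in> D" using t tt by (simp add: D_def m_assoc cancel)
  have conj1: "inv t \<otimes> d \<otimes> t \<in> D" if d: "d \<in> D" for d
  proof -
    have "inv t \<otimes> (inv t \<otimes> d \<otimes> t) \<otimes> t = inv (t \<otimes> t) \<otimes> d \<otimes> (t \<otimes> t)"
      using t DC[OF d] by (simp add: inv_mult_group m_assoc)
    also have "\<dots> \<in> H" using d tt by (simp add: D_def)
    finally show ?thesis using d by (simp add: D_def)
  qed
  show conj2: "t \<otimes> d \<otimes> inv t \<in> D" if d: "d \<in> D" for d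
  proof -
    \<comment> \<open>Conjugation by t is conjugation by t^-1 followed by conjugation by t^2, an
      element of \<open>D\<close>.\<close>
    have "t \<otimes> d \<otimes> inv t = (t \<otimes> t) \<otimes> (inv t \<otimes> d \<otimes> t) \<otimes> inv (t \<otimes> t)"
      using t DC[OF d] by (simp add: inv_mult_group m_assoc cancel)
    also have "\<dots> \<in> D" using ttD conj1[OF d] by (simp add: D_closed)
    finally show ?thesis .
  qed
  show "subgroup (D \<union> (\<lambda>d. t \<otimes> d) ` D) G"
  proof (rule subgroup.intro)
    show "D \<union> (\<lambda>d. t \<otimes> d) ` D \<subseteq> carrier G" using DC t by auto
    show "\<one> \<in> D \<union> (\<lambda>d. t \<otimes> d) ` D" using D_closed by blast
  next
    fix x assume "x \<in> D \<union> (\<lambda>d. t \<otimes> d) ` D"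
    then consider "x \<in> D" | d where "d \<in> D" "x = t \<otimes> d" by blast
    then show "inv x \<in> D \<union> (\<lambda>d. t \<otimes> d) ` D"
    proof cases
      case 1
      then show ?thesis using D_closed by blast
    next
      case 2
      have "inv x = t \<otimes> ((inv t \<otimes> inv d \<otimes> t) \<otimes> inv (t \<otimes> t))"
        using t DC[OF 2(1)] 2(2) by (simp add: inv_mult_group m_assoc cancel)
      moreover have "(inv t \<otimes> inv d \<otimes> t) \<otimes> inv (t \<otimes> t) \<in> D"
        using 2(1) ttD by (simp add: D_closed conj1)
      ultimately show ?thesis by blast
    qed
  next
    fix x y assume "x \<in> D \<union> (\<lambda>d. t \<otimes> d) ` D" "y \<in> D \<union> (\<lambda>d. t \<otimes> d) ` D"
    then consider "x \<in> D" "y \<in> D" | d where "d \<in> D" "x = t \<otimes> d" "y \<in> D"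
      | e where "x \<in> D" "e \<in> D" "y = t \<otimes> e"
      | d e where "d \<in> D" "x = t \<otimes> d" "e \<in> D" "y = t \<otimes> e" by blast
    then show "x \<otimes> y \<in> D \<union> (\<lambda>d. t \<otimes> d) ` D"
    proof cases
      case 1
      then show ?thesis using D_closed by blast
    next
      case 2
      then have "x \<otimes> y = t \<otimes> (d \<otimes> y)" using t DC by (simp add: m_assoc)
      then show ?thesis using 2 D_closed by blast
    next
      case 3
      then have "x \<otimes> y = t \<otimes> ((inv t \<otimes> x \<otimes> t) \<otimes> e)" using t DC by (simp add: m_assoc cancel)
      then show ?thesis using 3 conj1 D_closed by blast
    next
      case 4
      then have "x \<otimes> y = (t \<otimes> t) \<otimes> (inv t \<otimes> d \<otimes> t) \<otimes> e" using t DC by (simp add: m_assoc cancel)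
      moreover have "(t \<otimes> t) \<otimes> (inv t \<otimes> d \<otimes> t) \<otimes> e \<in> D"
        using 4 ttD by (simp add: D_closed conj1)
      ultimately show ?thesis by simp
    qed
  qed
qed

text \<open>If h = d r with d in \<open>I\<close>, then h and r have the same coset, so finitely
  many r give finitely many cosets.\<close>

lemma (in group) finite_rcosetsI:
  assumes I: "subgroup I G" and "D \<subseteq> I" and R: "finite R" "R \<subseteq> carrier G"
    and cover: "\<And>h. h \<in> H \<Longrightarrow> \<exists>d\<in>D. \<exists>r\<in>R. h = d \<otimes> r"
  shows "finite (rcosets\<^bsub>G\<lparr>carrier := H\<rparr>\<^esub> I)"
proof (rule finite_subset)
  show "rcosets\<^bsub>G\<lparr>carrier := H\<rparr>\<^esub> I \<subseteq> (\<lambda>r. I #> r) ` R"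
  proof
    fix X assume "X \<in> rcosets\<^bsub>G\<lparr>carrier := H\<rparr>\<^esub> I"
    then obtain h where h: "h \<in> H" "X = I #> h" by (auto simp: RCOSETS_def r_coset_def)
    obtain d r where dr: "d \<in> D" "r \<in> R" "h = d \<otimes> r" using cover h by blast
    have "d \<in> I" using dr assms(2) by blast
    then have "I #> h = (I #> d) #> r"
      using dr R(2) subgroup.subset[OF I] by (auto simp: coset_mult_assoc subgroup.mem_carrier[OF I])
    also have "I #> d = I" using \<open>d \<in> I\<close> I by (simp add: coset_join2 subgroup.mem_carrier)
    finally show "X \<in> (\<lambda>r. I #> r) ` R" using h dr by blast
  qed
qed (use R in simp)

section \<open>Linear groups over a subring of the reals\<close>

lemma GL_real_simps [simp]:
  "carrier GL_real = {T. invertible T}" "mult GL_real = (**)" "one GL_real = mat 1"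
  by (simp_all add: GL_real_def)

lemma group_GL_real: "group (GL_real :: (real^'k::finite^'k) monoid)"
proof (rule groupI)
  fix x :: "real^'k^'k" assume "x \<in> carrier GL_real"
  then have x: "invertible x" by simp
  have "invertible (matrix_inv x)" using matrix_inv_eqI(1)[OF matrix_inv_inverse(2)[OF x]] .
  then show "\<exists>y\<in>carrier GL_real. y \<otimes>\<^bsub>GL_real\<^esub> x = \<one>\<^bsub>GL_real\<^esub>"
    using matrix_inv_inverse(2)[OF x] by auto
qed (auto simp: invertible_mult matrix_mul_assoc invertible_mat_1)

lemma inv_GL_real: "invertible T \<Longrightarrow> inv\<^bsub>GL_real\<^esub> (T :: real^'k::finite^'k) = matrix_inv T"
  using group.inv_equality[OF group_GL_real, of "matrix_inv T" T] matrix_inv_inverse[of T]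
    matrix_inv_eqI(1)[OF matrix_inv_inverse(2)[of T]] by simp

text \<open>Covers both \<open>ring_of_integers K\<close> and \<open>UNIV\<close>, so that the
  arithmetic group and the ambient real group are instances of the same statements.\<close>

definition real_subring :: "real set \<Rightarrow> bool" where
  "real_subring R \<longleftrightarrow> 0 \<in> R \<and> 1 \<in> R \<and>
     (\<forall>x\<in>R. \<forall>y\<in>R. x + y \<in> R \<and> x * y \<in> R) \<and> (\<forall>x\<in>R. - x \<in> R)"

definition matrix_over :: "real set \<Rightarrow> real^'k::finite^'k \<Rightarrow> bool" where
  "matrix_over R T \<longleftrightarrow> (\<forall>i j. T $ i $ j \<in> R)"

lemma matrix_over_UNIV [simp]: "matrix_over UNIV T"
  by (simp add: matrix_over_def)

lemma GL_over_iff: "T \<in> GL_over R \<longleftrightarrow> invertible T \<and> matrix_over R T \<and> matrix_over R (matrix_inv T)"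
  by (auto simp: GL_over_def matrix_over_def)

lemma matrix_over_mult:
  assumes "real_subring R" "matrix_over R S" "matrix_over R T"
  shows "matrix_over R (S ** T)"
proof -
  have "(\<Sum>k\<in>X. f k) \<in> R" if "\<And>k. f k \<in> R" for f :: "'a \<Rightarrow> real" and X
    using that assms(1) by (induction X rule: infinite_finite_induct) (auto simp: real_subring_def)
  then show ?thesis
    using assms by (auto simp: matrix_over_def matrix_matrix_mult_def real_subring_def)
qed

lemma matrix_over_add:
  "real_subring R \<Longrightarrow> matrix_over R S \<Longrightarrow> matrix_over R T \<Longrightarrow> matrix_over R (S + T)"
  by (auto simp: matrix_over_def real_subring_def)

lemma matrix_over_minus: "real_subring R \<Longrightarrow> matrix_over R T \<Longrightarrow> matrix_over R (- T)"
  by (auto simp: matrix_over_def real_subring_def)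

lemma matrix_over_mat_1: "real_subring R \<Longrightarrow> matrix_over R (mat 1)"
  by (auto simp: matrix_over_def real_subring_def mat_def)

lemma matrix_inv_mult:
  fixes S T :: "real^'k::finite^'k"
  assumes "invertible S" "invertible T"
  shows "matrix_inv (S ** T) = matrix_inv T ** matrix_inv S"
proof (rule matrix_inv_eqI(2))
  have "S ** T ** (matrix_inv T ** matrix_inv S) = S ** (T ** matrix_inv T) ** matrix_inv S"
    by (simp add: matrix_mul_assoc)
  then show "S ** T ** (matrix_inv T ** matrix_inv S) = mat 1"
    by (simp add: matrix_inv_inverse assms)
qed

lemma invertible_matrix_inv:
  fixes T :: "real^'k::finite^'k"
  assumes "invertible T"
  shows "invertible (matrix_inv T)" "matrix_inv (matrix_inv T) = T"
  using matrix_inv_eqI[OF matrix_inv_inverse(2)[OF assms]] by auto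

lemma subgroup_O_prime:
  assumes R: "real_subring R"
  shows "subgroup (O_prime A R) GL_real"
proof (rule subgroup.intro)
  show "O_prime A R \<subseteq> carrier GL_real" by (auto simp: O_prime_def GL_over_def)
  show "\<one>\<^bsub>GL_real\<^esub> \<in> O_prime A R"
    using R matrix_inv_eqI(2)[of "mat 1" "mat 1 :: real^'a^'a"]
    by (auto simp: O_prime_def GL_over_iff matrix_over_mat_1 invertible_mat_1)
next
  fix S T assume S: "S \<in> O_prime A R" and T: "T \<in> O_prime A R"
  have "transpose (S ** T) ** A ** (S ** T) = transpose T ** (transpose S ** A ** S) ** T"
    by (simp add: matrix_transpose_mul matrix_mul_assoc)
  also have "\<dots> = A" using S T by (simp add: O_prime_def)
  finally have "transpose (S ** T) ** A ** (S ** T) = A" .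
  moreover have "(*v) (S ** T) ` C = (*v) S ` (*v) T ` C" for C
    unfolding image_image by (simp add: matrix_vector_mul_assoc)
  ultimately show "S \<otimes>\<^bsub>GL_real\<^esub> T \<in> O_prime A R"
    using S T R by (simp add: O_prime_def GL_over_iff invertible_mult matrix_inv_mult matrix_over_mult)
next
  fix T assume T: "T \<in> O_prime A R"
  then have inv: "invertible T" by (simp add: O_prime_def GL_over_iff)
  note TT = matrix_inv_inverse[OF inv]
  let ?U = "matrix_inv T"
  have "transpose ?U ** A ** ?U = transpose ?U ** (transpose T ** A ** T) ** ?U"
    using T by (simp add: O_prime_def)
  also have "\<dots> = transpose (T ** ?U) ** A ** (T ** ?U)" by (simp add: matrix_transpose_mul matrix_mul_assoc)
  finally have form: "transpose ?U ** A ** ?U = A" by (simp add: TT transpose_mat)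
  have "(*v) ?U ` C = C" if "(*v) T ` C = C" for C
  proof -
    have "(*v) ?U ` C = (*v) ?U ` (*v) T ` C" using that by simp
    also have "\<dots> = C" unfolding image_image by (simp add: matrix_vector_mul_assoc TT)
    finally show ?thesis .
  qed
  then show "inv\<^bsub>GL_real\<^esub> T \<in> O_prime A R"
    using T form unfolding inv_GL_real[OF inv]
    by (simp add: O_prime_def GL_over_iff invertible_matrix_inv[OF inv])
qed

lemma O_prime_eq: "O_prime A R = O_prime A UNIV \<inter> GL_over R"
  by (auto simp: O_prime_def GL_over_iff)

lemma finite_matrices_over:
  assumes "finite R"
  shows "finite {T :: real^'k::finite^'k. matrix_over R T}"
proof (rule finite_subset)
  show "{T :: real^'k^'k. matrix_over R T} \<subseteq> (\<lambda>f. \<chi> i j. f (i, j)) ` (UNIV \<rightarrow>\<^sub>E R)"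
  proof
    fix T :: "real^'k^'k" assume "T \<in> {T. matrix_over R T}"
    then have "T = (\<chi> i j. (\<lambda>(i, j). T $ i $ j) (i, j))" "(\<lambda>(i, j). T $ i $ j) \<in> UNIV \<rightarrow>\<^sub>E R"
      by (auto simp: matrix_over_def vec_eq_iff)
    then show "T \<in> (\<lambda>f. \<chi> i j. f (i, j)) ` (UNIV \<rightarrow>\<^sub>E R)" by (rule image_eqI)
  qed
  show "finite ((\<lambda>f. \<chi> i j. f (i, j)) ` ((UNIV :: ('k \<times> 'k) set) \<rightarrow>\<^sub>E R) :: (real^'k^'k) set)"
    using assms by (intro finite_imageI finite_PiE) auto
qed

lemma scaleR_matrix_mult:
  fixes S T :: "real^'k::finite^'k"
  shows "(c *\<^sub>R S) ** T = c *\<^sub>R (S ** T)" "S ** (c *\<^sub>R T) = c *\<^sub>R (S ** T)"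
  by (simp_all add: matrix_matrix_mult_def vec_eq_iff sum_distrib_left mult_ac)

text \<open>If \<open>T\<close> is integral and divides the scalar \<open>a\<close>, conjugation by \<open>T\<close> keeps the principal
  congruence subgroup of level \<open>a\<close> integral.\<close>

lemma conj_congruence_subgroup:
  fixes t T U g k :: "real^'k::finite^'k"
  assumes R: "real_subring R" and TU: "matrix_over R T" "matrix_over R U"
    and t: "t = c *\<^sub>R T" "c \<noteq> 0" "a \<noteq> 0" "U ** T = a *\<^sub>R mat 1"
    and g: "g \<in> GL_over R" "g = mat 1 + a *\<^sub>R k" "matrix_over R k"
  shows "invertible t" "matrix_inv t ** g ** t \<in> GL_over R"
proof -
  have "(inverse (c * a) *\<^sub>R U) ** t = mat 1"
    using t(2-) by (simp add: t(1) scaleR_matrix_mult field_simps)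
  then have tinv: "t ** (inverse (c * a) *\<^sub>R U) = mat 1" using matrix_left_right_inverse by blast
  show inv: "invertible t" by (rule matrix_inv_eqI(1)[OF tinv])
  have mi: "matrix_inv t = inverse (c * a) *\<^sub>R U" by (rule matrix_inv_eqI(2)[OF tinv])
  \<comment> \<open>The inverse of t is (c a)^-1 U, so the factor a of the congruence cancels the
    denominator.\<close>
  have conj: "matrix_inv t ** (mat 1 + a *\<^sub>R m) ** t = mat 1 + U ** m ** T" for m
  proof -
    have "matrix_inv t ** (mat 1 + a *\<^sub>R m) ** t
        = inverse (c * a) *\<^sub>R (U ** (mat 1 + a *\<^sub>R m) ** (c *\<^sub>R T))"
      unfolding mi unfolding t(1) by (simp add: scaleR_matrix_mult)
    also have "\<dots> = (inverse (c * a) * c) *\<^sub>R (U ** T + a *\<^sub>R (U ** m ** T))"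
      by (simp add: matrix_add_ldistrib matrix_add_rdistrib scaleR_matrix_mult)
    also have "\<dots> = mat 1 + U ** m ** T" using t(2,3)
      by (simp add: t(4) scaleR_add_right field_simps)
    finally show ?thesis .
  qed
  let ?h = "matrix_inv g"
  have gi: "invertible g" "matrix_over R ?h" using g by (simp_all add: GL_over_iff)
  \<comment> \<open>\<open>GL_over\<close> also asks for an integral inverse. The inverse of g is
    again 1 modulo a, so the same computation applies to it.\<close>
  have "?h ** g = ?h + a *\<^sub>R (?h ** k)" unfolding g(2)
    by (simp add: matrix_add_ldistrib scaleR_matrix_mult)
  then have h: "?h = mat 1 + a *\<^sub>R (- (?h ** k))" using matrix_inv_inverse(2)[OF gi(1)] by (simp add: algebra_simps)
  have "matrix_inv (matrix_inv t ** g ** t) = matrix_inv t ** ?h ** t"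
    using inv gi by (simp add: matrix_inv_mult invertible_mult invertible_matrix_inv matrix_mul_assoc)
  also have "\<dots> = mat 1 + U ** (- (?h ** k)) ** T" by (subst h) (rule conj)
  finally have "matrix_over R (matrix_inv (matrix_inv t ** g ** t))"
    using R TU gi(2) g(3)
    by (simp add: matrix_over_add matrix_over_mat_1 matrix_over_mult matrix_over_minus)
  moreover have "matrix_over R (matrix_inv t ** g ** t)"
    unfolding g(2) conj using R TU g(3)
    by (simp add: matrix_over_add matrix_over_mat_1 matrix_over_mult)
  ultimately show "matrix_inv t ** g ** t \<in> GL_over R"
    using inv gi(1) by (simp add: GL_over_iff invertible_mult invertible_matrix_inv)
qed

text \<open>In the group D \<union> t D the subgroup D has index at most 2. In H, two matrices with
  equal entries modulo a differ by a factor congruent to 1 modulo a, and such a factor lies in D by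
  \<open>conj_congruence_subgroup\<close>.\<close>

lemma commensurable_extension:
  fixes A t T U :: "real^'k::finite^'k"
  assumes R: "real_subring R" and fin: "finite X" "\<And>x. x \<in> R \<Longrightarrow> \<exists>r\<in>X. \<exists>k\<in>R. x = r + a * k"
    and TU: "matrix_over R T" "matrix_over R U"
    and t: "t = c *\<^sub>R T" "c \<noteq> 0" "a \<noteq> 0" "U ** T = a *\<^sub>R mat 1"
    and tA: "t \<in> O_prime A UNIV" and tt: "t ** t \<in> O_prime A R"
  obtains \<Gamma> where "subgroup \<Gamma> GL_real" "\<Gamma> \<subseteq> O_prime A UNIV" "t \<in> \<Gamma>"
    "commensurable GL_real \<Gamma> (O_prime A R)"
proof -
  let ?G = "GL_real :: (real^'k^'k) monoid"
  let ?H = "O_prime A R"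
  interpret G: group ?G by (rule group_GL_real)
  have UN: "subgroup (O_prime A UNIV) ?G" by (rule subgroup_O_prime) (simp add: real_subring_def)
  have H: "subgroup ?H ?G" by (rule subgroup_O_prime[OF R])
  have HU: "?H \<subseteq> O_prime A UNIV" using O_prime_eq[of A R] by blast
  have inv: "invertible t" using tA by (simp add: O_prime_def GL_over_iff)
  define D where "D = {h \<in> ?H. inv\<^bsub>?G\<^esub> t \<otimes>\<^bsub>?G\<^esub> h \<otimes>\<^bsub>?G\<^esub> t \<in> ?H}"
  note ext = G.subgroup_extend_by_square_root[OF H, of t, folded D_def]
  have D: "subgroup D ?G" and ext_sub: "subgroup (D \<union> (\<lambda>d. t ** d) ` D) ?G"
    and conj: "\<And>d. d \<in> D \<Longrightarrow> t ** d ** matrix_inv t \<in> D"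
    using ext tt inv inv_GL_real[OF inv] by simp_all
  define \<Gamma> where "\<Gamma> = D \<union> (\<lambda>d. t ** d) ` D"
  have oneD: "mat 1 \<in> D" using subgroup.one_closed[OF D] by simp
  have t\<Gamma>: "t \<in> \<Gamma>" unfolding \<Gamma>_def using oneD by (auto intro!: image_eqI[of _ _ "mat 1"])
  have DU: "D \<subseteq> O_prime A UNIV" using HU by (auto simp: D_def)
  then have "\<Gamma> \<subseteq> O_prime A UNIV"
    using tA subgroup.m_closed[OF UN tA] by (auto simp: \<Gamma>_def)
  moreover have "commensurable ?G \<Gamma> ?H"
    unfolding commensurable_def
  proof
    have I: "subgroup (\<Gamma> \<inter> ?H) ?G" using ext_sub H unfolding \<Gamma>_def by (rule G.subgroups_Inter_pair)
    have DI: "D \<subseteq> \<Gamma> \<inter> ?H" by (auto simp: \<Gamma>_def D_def)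
    show "finite (rcosets\<^bsub>?G\<lparr>carrier := \<Gamma>\<rparr>\<^esub> (\<Gamma> \<inter> ?H))"
    proof (rule G.finite_rcosetsI[OF I DI])
      show "finite {mat 1, t}" "{mat 1, t} \<subseteq> carrier ?G" using inv by (auto simp: invertible_mat_1)
      fix h assume "h \<in> \<Gamma>"
      then consider "h \<in> D" | d where "d \<in> D" "h = t ** d" by (auto simp: \<Gamma>_def)
      then show "\<exists>d\<in>D. \<exists>r\<in>{mat 1, t}. h = d \<otimes>\<^bsub>?G\<^esub> r"
      proof cases
        case 1
        then show ?thesis by (intro bexI[of _ h] bexI[of _ "mat 1"]) auto
      next
        case 2
        \<comment> \<open>The cosets counted are right cosets, so t is moved to the right.\<close>
        have "h = (t ** d ** matrix_inv t) ** t"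
          using 2(2) matrix_inv_inverse(2)[OF inv] by (simp flip: matrix_mul_assoc)
        then show ?thesis using conj[OF 2(1)] by (intro bexI[of _ "t ** d ** matrix_inv t"] bexI[of _ t]) auto
      qed
    qed
    obtain rep where rep: "\<And>x. x \<in> R \<Longrightarrow> rep x \<in> X" "\<And>x. x \<in> R \<Longrightarrow> \<exists>k\<in>R. x = rep x + a * k"
      using fin(2) by metis
    \<comment> \<open>Entrywise reduction modulo a. It takes finitely many values on
      \<open>?H\<close>, and \<open>S\<close> picks one element over each.\<close>
    define \<phi> where "\<phi> = (\<lambda>g :: real^'k^'k. \<chi> i j. rep (g $ i $ j))"
    have overH: "matrix_over R g" "matrix_over R (matrix_inv g)" "invertible g" if "g \<in> ?H" for g
      using that by (simp_all add: O_prime_def GL_over_iff)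
    have "\<phi> ` ?H \<subseteq> {T. matrix_over X T}" using overH(1) rep(1) by (auto simp: \<phi>_def matrix_over_def)
    then have fin\<phi>: "finite (\<phi> ` ?H)" using finite_matrices_over[OF fin(1)] finite_subset by blast
    define S where "S = (\<lambda>v. SOME h. h \<in> ?H \<and> \<phi> h = v) ` \<phi> ` ?H"
    have S: "\<exists>r\<in>S. r \<in> ?H \<and> \<phi> r = \<phi> h" if "h \<in> ?H" for h
    proof -
      have "(SOME h'. h' \<in> ?H \<and> \<phi> h' = \<phi> h) \<in> ?H \<and> \<phi> (SOME h'. h' \<in> ?H \<and> \<phi> h' = \<phi> h) = \<phi> h"
        using that by (intro someI_ex[of "\<lambda>h'. h' \<in> ?H \<and> \<phi> h' = \<phi> h"]) blast
      then show ?thesis using that unfolding S_def by blast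
    qed
    show "finite (rcosets\<^bsub>?G\<lparr>carrier := ?H\<rparr>\<^esub> (\<Gamma> \<inter> ?H))"
    proof (rule G.finite_rcosetsI[OF I DI])
      show "finite (S \<inter> ?H)" using fin\<phi> by (simp add: S_def)
      show "S \<inter> ?H \<subseteq> carrier ?G" using overH(3) by auto
      fix g assume g: "g \<in> ?H"
      then obtain r where r: "r \<in> S" "r \<in> ?H" "\<phi> r = \<phi> g" using S by blast
      note gR = overH[OF g] and rR = overH[OF r(2)]
      have "\<forall>i j. \<exists>k\<in>R. g $ i $ j - r $ i $ j = a * k"
      proof (intro allI)
        fix i j
        obtain k k' where k: "k \<in> R" "g $ i $ j = rep (g $ i $ j) + a * k"
          "k' \<in> R" "r $ i $ j = rep (r $ i $ j) + a * k'"
          using rep(2) gR(1) rR(1) unfolding matrix_over_def by meson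
        have "rep (r $ i $ j) = rep (g $ i $ j)" using r(3) by (simp add: \<phi>_def vec_eq_iff)
        then have "g $ i $ j - r $ i $ j = a * (k + - k')" using k(2,4) by (simp add: algebra_simps)
        moreover have "k + - k' \<in> R" using R k(1,3) unfolding real_subring_def by blast
        ultimately show "\<exists>k\<in>R. g $ i $ j - r $ i $ j = a * k" by blast
      qed
      then obtain K where K: "\<And>i j. K i j \<in> R" "\<And>i j. g $ i $ j - r $ i $ j = a * K i j" by metis
      define k where "k = (\<chi> i j. K i j) ** matrix_inv r"
      have "matrix_over R (\<chi> i j. K i j)" using K(1) by (simp add: matrix_over_def)
      then have kR: "matrix_over R k" unfolding k_def using R rR by (intro matrix_over_mult)
      have "g = r + a *\<^sub>R (\<chi> i j. K i j)" using K(2) by (simp add: vec_eq_iff algebra_simps)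
      then have d: "g ** matrix_inv r = mat 1 + a *\<^sub>R k"
        using matrix_inv_inverse(1)[OF rR(3)]
        by (simp add: k_def matrix_add_rdistrib scaleR_matrix_mult)
      have dH: "g ** matrix_inv r \<in> ?H"
        using subgroup.m_closed[OF H g subgroup.m_inv_closed[OF H r(2)]] by (simp add: inv_GL_real rR(3))
      then have "matrix_inv t ** (g ** matrix_inv r) ** t \<in> GL_over R"
        using conj_congruence_subgroup(2)[OF R TU t _ d kR] by (simp add: O_prime_def)
      moreover have "matrix_inv t ** (g ** matrix_inv r) ** t \<in> O_prime A UNIV"
        using subgroup.m_closed[OF UN subgroup.m_closed[OF UN subgroup.m_inv_closed[OF UN tA]] tA, of "g ** matrix_inv r"] dH HU
        by (auto simp: inv_GL_real inv)
      ultimately have "g ** matrix_inv r \<in> D"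
        using dH inv by (auto simp: D_def inv_GL_real O_prime_eq[of A R])
      moreover have "g = (g ** matrix_inv r) ** r"
        using matrix_inv_inverse(2)[OF rR(3)] by (simp flip: matrix_mul_assoc)
      ultimately show "\<exists>d\<in>D. \<exists>r\<in>S \<inter> ?H. g = d \<otimes>\<^bsub>?G\<^esub> r" using r by auto
    qed
  qed
  ultimately show ?thesis using that ext_sub t\<Gamma> unfolding \<Gamma>_def by blast
qed

section \<open>Finite quotients of the ring of integers\<close>

lemma real_subring_ring_of_integers:
  assumes "real_subfield K"
  shows "real_subring (ring_of_integers K)"
  using assms algebraic_int_add_mult_real
  by (auto simp: real_subring_def ring_of_integers_def real_subfield_def int_imp_algebraic_int)

lemma of_int_mem_ring_of_integers:
  assumes "real_subfield K"
  shows "of_int i \<in> ring_of_integers K"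
proof -
  have "field_embedding K (\<lambda>x. x)" by (simp add: field_embedding_def)
  from field_embedding_of_rat(1)[OF assms this, of "of_int i"] show ?thesis
    by (simp add: ring_of_integers_def int_imp_algebraic_int)
qed

text \<open>An integral equation c + a q(a) = 0 with c nonzero shows that \<open>a\<close> divides
  c. A zero constant term is removed by cancelling a factor \<open>a\<close>, which is the
  induction.\<close>

lemma algebraic_int_dvd_nat:
  fixes a :: real
  assumes a: "a \<in> ring_of_integers K" "a \<noteq> 0" and K: "real_subfield K"
  shows "\<exists>N>0. \<exists>k\<in>ring_of_integers K. real N = a * k"
proof -
  have R: "real_subring (ring_of_integers K)" by (rule real_subring_ring_of_integers[OF K])
  note int = of_int_mem_ring_of_integers[OF K]
  have mem: "poly (map_poly of_int q) a \<in> ring_of_integers K" for q :: "int poly"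
    by (induction q) (use R int a(1) in \<open>auto simp: real_subring_def map_poly_pCons\<close>)
  have *: "\<exists>N>0. \<exists>k\<in>ring_of_integers K. real N = a * k"
    if "q \<noteq> 0" "poly (map_poly of_int q) a = 0" for q :: "int poly"
    using that
  proof (induction q)
    case (pCons c q)
    show ?case
    proof (cases "c = 0")
      case True
      then show ?thesis using pCons a(2) by (auto simp: map_poly_pCons)
    next
      case False
      let ?k = "poly (map_poly of_int q) a"
      have "of_int c + a * ?k = 0" using pCons.prems by (simp add: map_poly_pCons)
      then have "of_int c = a * (- ?k)" by simp
      then have "real (nat \<bar>c\<bar>) = a * (of_int (- sgn c) * ?k)"
        by (simp add: abs_sgn[of c] sgn_if)
      moreover have "of_int (- sgn c) * ?k \<in> ring_of_integers K"
        using R mem[of q] int[of "- sgn c"] unfolding real_subring_def by blast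
      moreover have "nat \<bar>c\<bar> > 0" using False by simp
      ultimately show ?thesis by blast
    qed
  qed simp
  obtain q :: "int poly" where "poly (map_poly of_int q) a = 0" "lead_coeff q = 1"
    using a(1) algebraic_int_altdef_ipoly unfolding ring_of_integers_def by blast
  then show ?thesis using *[of q] by fastforce
qed

text \<open>As \<open>a\<close> divides a positive integer N, representatives modulo N also serve
  modulo \<open>a\<close>; modulo N only the additive group matters, and it has finite rank.\<close>

lemma ring_of_integers_finite_quotient:
  assumes K: "number_field K" and a: "a \<in> ring_of_integers K" "a \<noteq> 0"
  obtains X where "finite X" "\<And>x. x \<in> ring_of_integers K \<Longrightarrow> \<exists>r\<in>X. \<exists>k\<in>ring_of_integers K. x = r + a * k"
proof -
  have sub: "real_subfield K" using K by (simp add: number_field_def)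
  have R: "real_subring (ring_of_integers K)" by (rule real_subring_ring_of_integers[OF sub])
  obtain N k0 where N: "N > 0" "k0 \<in> ring_of_integers K" "real N = a * k0"
    using algebraic_int_dvd_nat[OF a sub] by blast
  obtain B where B: "finite B" "\<And>x. x \<in> K \<Longrightarrow> \<exists>c :: real \<Rightarrow> rat. x = (\<Sum>b\<in>B. of_rat (c b) * b)"
    using K unfolding number_field_def by blast
  have int: "of_int i * x \<in> ring_of_integers K" if "x \<in> ring_of_integers K" for i x
    using R that of_int_mem_ring_of_integers[OF sub] unfolding real_subring_def by blast
  have sp: "zmod.subspace (ring_of_integers K)"
    using R int by (intro zmod.subspaceI) (auto simp: real_subring_def)
  have coords: "\<exists>c :: real \<Rightarrow> rat. x = (\<Sum>b\<in>B. of_rat (c b) * b)" if "x \<in> ring_of_integers K" for x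
    using B(2) that by (simp add: ring_of_integers_def)
  obtain X where X: "finite X" "X \<subseteq> ring_of_integers K"
    "\<And>h. h \<in> ring_of_integers K \<Longrightarrow> \<exists>r\<in>X. \<exists>k\<in>ring_of_integers K. h = r + real N * k"
    by (rule finite_rank_subgroup_mod_nat[OF B(1) N(1) sp coords]) blast+
  have "\<exists>r\<in>X. \<exists>k\<in>ring_of_integers K. x = r + a * k" if x: "x \<in> ring_of_integers K" for x
  proof -
    obtain r k where rk: "r \<in> X" "k \<in> ring_of_integers K" "x = r + real N * k" using X(3)[OF x] by blast
    have "k0 * k \<in> ring_of_integers K" using R N(2) rk(2) by (simp add: real_subring_def)
    moreover have "x = r + a * (k0 * k)" using rk(3) N(3) by simp
    ultimately show ?thesis using rk(1) by blast
  qed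
  then show ?thesis using that X(1) by blast
qed

section \<open>Block matrices and boosts\<close>

lemma sum_UNIV_option:
  fixes f :: "'n::finite option \<Rightarrow> real"
  shows "(\<Sum>i\<in>UNIV. f i) = f None + (\<Sum>i\<in>UNIV. f (Some i))"
  by (simp add: UNIV_option_conv sum.reindex)

text \<open>A fixed-point free involution splits the n + 1 coordinates into pairs, with
  \<open>S\<close> holding one member of each. The pair of \<open>None\<close> will carry the norm
  form, the others the planes u^2 + a v^2.\<close>

locale index_pairing =
  fixes p :: "'n::finite option \<Rightarrow> 'n option" and S :: "'n option set"
  assumes p_p [simp]: "p (p i) = i" and p_S [simp]: "p i \<in> S \<longleftrightarrow> i \<notin> S" and None_S [simp]: "None \<in> S"
begin

lemma p_neq [simp]: "p i \<noteq> i" "i \<noteq> p i"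
  using p_S[of i] by metis+

lemma p_eq_None_iff [simp]: "p i = None \<longleftrightarrow> i = p None"
  by (metis p_p)

lemma p_inject [simp]: "p i = p j \<longleftrightarrow> i = j"
  by (metis p_p)

definition pair_matrix :: "('n option \<Rightarrow> real) \<Rightarrow> ('n option \<Rightarrow> real) \<Rightarrow> real^('n option)^('n option)" where
  "pair_matrix D E = (\<chi> i j. if j = i then D i else if j = p i then E i else 0)"

lemma pair_matrix_vec: "(pair_matrix D E *v x) $ i = D i * x $ i + E i * x $ p i"
proof -
  let ?f = "\<lambda>j. (if j = i then D i else if j = p i then E i else 0) * x $ j"
  have "(pair_matrix D E *v x) $ i = sum ?f UNIV"
    unfolding pair_matrix_def matrix_vector_mult_def by simp
  also have "\<dots> = sum ?f {i, p i}" by (rule sum.mono_neutral_right) auto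
  also have "\<dots> = D i * x $ i + E i * x $ p i" by simp
  finally show ?thesis .
qed

lemma pair_matrix_mult:
  "pair_matrix D E ** pair_matrix D' E'
     = pair_matrix (\<lambda>i. D i * D' i + E i * E' (p i)) (\<lambda>i. D i * E' i + E i * D' (p i))"
  unfolding matrix_eq
  by (simp add: vec_eq_iff pair_matrix_vec algebra_simps flip: matrix_vector_mul_assoc)

lemma transpose_pair_matrix: "transpose (pair_matrix D E) = pair_matrix D (\<lambda>i. E (p i))"
  by (auto simp: transpose_def pair_matrix_def vec_eq_iff)

text \<open>All pairs other than that of \<open>None\<close> are to carry the same block, so four
  values suffice for a diagonal.\<close>

definition sel :: "real \<Rightarrow> real \<Rightarrow> real \<Rightarrow> real \<Rightarrow> 'n option \<Rightarrow> real" where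
  "sel a b c d i = (if i = None then a else if i = p None then b else if i \<in> S then c else d)"

lemma sel_p: "sel a b c d (p i) = sel b a d c i"
  by (auto simp: sel_def)

text \<open>The block matrix with the block (\<open>a b\<close> / \<open>c d\<close>) on the coordinates \<open>None\<close>, \<open>p None\<close> and the
  block (\<open>e f\<close> / \<open>g h\<close>) on every other pair \<open>i\<close>, \<open>p i\<close> with \<open>i \<in> S\<close>.\<close>

definition blk :: "real \<Rightarrow> real \<Rightarrow> real \<Rightarrow> real \<Rightarrow> real \<Rightarrow> real \<Rightarrow> real \<Rightarrow> real \<Rightarrow> real^('n option)^('n option)" where
  "blk a b c d e f g h = pair_matrix (sel a d e h) (sel b c f g)"

lemma blk_mult: "blk a b c d e f g h ** blk a' b' c' d' e' f' g' h' =
  blk (a * a' + b * c') (a * b' + b * d') (c * a' + d * c') (c * b' + d * d')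
    (e * e' + f * g') (e * f' + f * h') (g * e' + h * g') (g * f' + h * h')"
  unfolding blk_def pair_matrix_mult sel_p
  by (intro arg_cong2[of _ _ _ _ pair_matrix] ext) (simp_all add: sel_def algebra_simps)

lemma transpose_blk: "transpose (blk a b c d e f g h) = blk a c b d e g f h"
  unfolding blk_def transpose_pair_matrix sel_p ..

lemma blk_1: "blk 1 0 0 1 1 0 0 1 = mat 1"
  by (auto simp: blk_def pair_matrix_def sel_def mat_def vec_eq_iff)

lemma scaleR_blk: "k *\<^sub>R blk a b c d e f g h
    = blk (k * a) (k * b) (k * c) (k * d) (k * e) (k * f) (k * g) (k * h)"
  by (auto simp: blk_def pair_matrix_def sel_def vec_eq_iff)

lemma map_blk:
  assumes "\<phi> 0 = 0"
  shows "(\<chi> i j. \<phi> (blk a b c d e f g h $ i $ j))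
    = blk (\<phi> a) (\<phi> b) (\<phi> c) (\<phi> d) (\<phi> e) (\<phi> f) (\<phi> g) (\<phi> h)"
  using assms by (auto simp: blk_def pair_matrix_def sel_def vec_eq_iff)

lemma matrix_over_blk:
  "0 \<in> R \<Longrightarrow> a \<in> R \<Longrightarrow> b \<in> R \<Longrightarrow> c \<in> R \<Longrightarrow> d \<in> R \<Longrightarrow> e \<in> R \<Longrightarrow> f \<in> R \<Longrightarrow> g \<in> R \<Longrightarrow> h \<in> R \<Longrightarrow>
    matrix_over R (blk a b c d e f g h)"
  by (auto simp: matrix_over_def blk_def pair_matrix_def sel_def)

lemma blk_vec:
  "(blk a b c d e f g h *v x) $ i =
    (if i = None then a * x $ None + b * x $ p None
     else if i = p None then c * x $ None + d * x $ p None
     else if i \<in> S then e * x $ i + f * x $ p i else g * x $ p i + h * x $ i)"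
  by (auto simp: blk_def pair_matrix_vec sel_def)

abbreviation "rest \<equiv> UNIV - {None, p None}"

lemma sum_split_first_pair:
  fixes f :: "'n option \<Rightarrow> real"
  shows "(\<Sum>i\<in>UNIV. f i) = f None + f (p None) + (\<Sum>i\<in>rest. f i)"
proof -
  have "(\<Sum>i\<in>UNIV. f i) = (\<Sum>i\<in>{None, p None}. f i) + (\<Sum>i\<in>rest. f i)"
    by (rule sum.subset_diff[THEN trans[OF _ add.commute]]) auto
  then show ?thesis by simp
qed

lemma qform_blk_symmetric:
  "qform (blk a b b d e 0 0 h) x = a * (x $ None)\<^sup>2 + 2 * b * x $ None * x $ p None + d * (x $ p None)\<^sup>2
    + (\<Sum>i\<in>rest. (if i \<in> S then e else h) * (x $ i)\<^sup>2)"
proof -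
  have "(\<Sum>i\<in>rest. x $ i * (blk a b b d e 0 0 h *v x) $ i) = (\<Sum>i\<in>rest. (if i \<in> S then e else h) * (x $ i)\<^sup>2)"
    by (rule sum.cong) (auto simp: blk_vec power2_eq_square)
  then show ?thesis unfolding qform_def inner_vec_def sum_split_first_pair
    by (simp add: blk_vec power2_eq_square algebra_simps)
qed

lemma lorentz_inner_split:
  "lorentz_inner x y = x $ p None * y $ p None - x $ None * y $ None + (\<Sum>i\<in>rest. x $ i * y $ i)"
proof -
  have "lorentz_inner x y = (\<Sum>i\<in>UNIV. x $ i * y $ i) - 2 * x $ None * y $ None"
    by (simp add: lorentz_inner_def sum_UNIV_option)
  then show ?thesis by (simp add: sum_split_first_pair)
qed

lemma lorentz_form_split:
  "lorentz_form x = (x $ p None)\<^sup>2 - (x $ None)\<^sup>2 + (\<Sum>i\<in>rest. (x $ i)\<^sup>2)"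
  using lorentz_inner_split[of x x] by (simp add: lorentz_form_def lorentz_inner_def power2_eq_square)

lemma lorentz_form_eq_qform: "lorentz_form x = qform (blk (-1) 0 0 1 1 0 0 1) x"
  by (simp add: qform_blk_symmetric lorentz_form_split)

lemma blk_symmetric: "transpose (blk a b b d e 0 0 h) = blk a b b d e 0 0 h"
  by (simp add: transpose_blk)

text \<open>The binary form has discriminant t^2 - 4 < 0; the proof completes the square. With t =
  \<sigma> y and h = t + 2 this is the conjugate form.\<close>

lemma positive_definite_blk:
  assumes "\<bar>t\<bar> < 2" "h > 0"
  shows "positive_definite (blk 1 (t / 2) (t / 2) 1 1 0 0 h)"
  unfolding positive_definite_def
proof (intro allI impI)
  fix x :: "real^('n option)" assume x: "x \<noteq> 0"
  let ?u = "x $ None" and ?v = "x $ p None"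
  have t2: "t\<^sup>2 < 4" using assms(1) abs_square_less_1[of "t / 2"] by (simp add: power_divide)
  have first: "?u\<^sup>2 + t * ?u * ?v + ?v\<^sup>2 = (?u + t / 2 * ?v)\<^sup>2 + (1 - t\<^sup>2 / 4) * ?v\<^sup>2"
    by (simp add: power2_eq_square algebra_simps)
  have f0: "(1 - t\<^sup>2 / 4) * ?v\<^sup>2 \<ge> 0" using t2 by simp
  have r0: "(if i \<in> S then 1 else h) * (x $ i)\<^sup>2 \<ge> 0" for i using assms(2) by simp
  have q: "qform (blk 1 (t / 2) (t / 2) 1 1 0 0 h) x
    = (?u + t / 2 * ?v)\<^sup>2 + (1 - t\<^sup>2 / 4) * ?v\<^sup>2 + (\<Sum>i\<in>rest. (if i \<in> S then 1 else h) * (x $ i)\<^sup>2)"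
    unfolding first[symmetric] by (simp add: qform_blk_symmetric)
  have ge: "(\<Sum>i\<in>rest. (if i \<in> S then 1 else h) * (x $ i)\<^sup>2) \<ge> 0" using r0 by (intro sum_nonneg)
  show "qform (blk 1 (t / 2) (t / 2) 1 1 0 0 h) x > 0"
  proof (rule ccontr)
    assume "\<not> ?thesis"
    then have z: "(?u + t / 2 * ?v)\<^sup>2 = 0" "(1 - t\<^sup>2 / 4) * ?v\<^sup>2 = 0"
      "(\<Sum>i\<in>rest. (if i \<in> S then 1 else h) * (x $ i)\<^sup>2) = 0"
      using f0 ge zero_le_power2[of "?u + t / 2 * ?v"] unfolding q by linarith+
    from z(2) have v: "?v = 0" using t2 by simp
    then have u: "?u = 0" using z(1) by simp
    have "\<forall>i\<in>rest. (if i \<in> S then 1 else h) * (x $ i)\<^sup>2 = 0"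
      using z(3) r0 by (subst (asm) sum_nonneg_eq_0_iff) auto
    then have "x $ i = 0" if "i \<in> rest" for i using that assms(2) by (auto split: if_splits)
    then have "x $ i = 0" for i using u v by (cases "i \<in> rest") auto
    then show False using x by (simp add: vec_eq_iff)
  qed
qed

text \<open>The normal form of the isometry t: a hyperbolic rotation in the plane of
  \<open>None\<close> and, on each other pair, a quarter turn, which is what (u, v) \<mapsto> (- a
  v, u) over sqrt a becomes after rescaling v. The sign \<open>s\<close> gives inverses the same
  shape.\<close>

definition boost :: "real \<Rightarrow> real \<Rightarrow> real^('n option)^('n option)" where
  "boost L s = blk (cosh L) (sinh L) (sinh L) (cosh L) 0 (- s) s 0"

lemma boost_inverse: "s\<^sup>2 = 1 \<Longrightarrow> boost L s ** boost (- L) (- s) = mat 1"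
  using hyperbolic_pythagoras[of L]
  by (simp add: boost_def blk_mult power2_eq_square flip: blk_1)

lemma boost_form:
  assumes "s\<^sup>2 = 1"
  shows "lorentz_form (boost L s *v x) = lorentz_form x"
proof -
  have sinh_sq: "sinh L * sinh L - cosh L * cosh L = -1" and cosh_sq: "cosh L * cosh L - sinh L * sinh L = 1"
    using hyperbolic_pythagoras[of L] by (simp_all add: power2_eq_square)
  have "transpose (boost L s) ** blk (-1) 0 0 1 1 0 0 1 ** boost L s = blk (-1) 0 0 1 1 0 0 1"
    using assms by (simp add: boost_def transpose_blk blk_mult power2_eq_square sinh_sq cosh_sq)
  then show ?thesis unfolding lorentz_form_eq_qform qform_congruence by simp
qed

lemma boost_hyp_space:
  assumes "s\<^sup>2 = 1" "x \<in> hyp_space"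
  shows "boost L s *v x \<in> hyp_space"
proof -
  have "(x $ p None)\<^sup>2 - (x $ None)\<^sup>2 + (\<Sum>i\<in>rest. (x $ i)\<^sup>2) = -1" "x $ None > 0"
    using assms(2) by (simp_all add: hyp_space_def lorentz_form_split)
  moreover have "(\<Sum>i\<in>rest. (x $ i)\<^sup>2) \<ge> 0" by (intro sum_nonneg) simp
  ultimately have "\<bar>x $ p None\<bar>\<^sup>2 < (x $ None)\<^sup>2" "x $ None \<ge> 0" unfolding power2_abs by linarith+
  then have "\<bar>x $ p None\<bar> < x $ None" by (rule power2_less_imp_less)
  moreover have "\<bar>sinh L\<bar>\<^sup>2 < (cosh L)\<^sup>2" using hyperbolic_pythagoras[of L] unfolding power2_abs by linarith
  then have "\<bar>sinh L\<bar> < cosh L" by (rule power2_less_imp_less) simp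
  ultimately have "\<bar>sinh L\<bar> * \<bar>x $ p None\<bar> < cosh L * x $ None"
    by (intro mult_strict_mono') auto
  then have "(boost L s *v x) $ None > 0"
    unfolding boost_def blk_vec abs_mult[symmetric] by simp
  then show ?thesis using assms by (simp add: hyp_space_def boost_form)
qed

lemma invertible_boost: "s\<^sup>2 = 1 \<Longrightarrow> invertible (boost L s)"
  using matrix_inv_eqI(1)[OF boost_inverse] by blast

lemma boost_O_plus:
  assumes "s\<^sup>2 = 1"
  shows "boost L s \<in> O_plus"
proof -
  have "x \<in> (*v) (boost L s) ` hyp_space" if "x \<in> hyp_space" for x
  proof
    show "boost (- L) (- s) *v x \<in> hyp_space" using assms that by (intro boost_hyp_space) simp_all
    show "x = boost L s *v (boost (- L) (- s) *v x)"
      using boost_inverse[OF assms] by (simp add: matrix_vector_mul_assoc)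
  qed
  then show ?thesis using assms boost_hyp_space boost_form unfolding O_plus_def by blast
qed

section \<open>The axis and the translation length of a boost\<close>

definition axis_point :: "real \<Rightarrow> real^('n option)" where
  "axis_point s = (\<chi> i. sel (cosh s) (sinh s) 0 0 i)"

lemma axis_point_nth [simp]: "axis_point s $ None = cosh s" "axis_point s $ p None = sinh s"
  "i \<noteq> None \<Longrightarrow> i \<noteq> p None \<Longrightarrow> axis_point s $ i = 0"
  by (auto simp: axis_point_def sel_def)

lemma axis_point_geodesic: "unit_speed_geodesic axis_point"
  unfolding unit_speed_geodesic_def
proof (intro conjI allI)
  have "axis_point s \<in> hyp_space" for s
    using hyperbolic_pythagoras[of s] by (simp add: hyp_space_def lorentz_form_split)
  then show "range axis_point \<subseteq> hyp_space" by blast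
  fix s t
  have "- lorentz_inner (axis_point s) (axis_point t) = cosh (s - t)"
    by (simp add: lorentz_inner_split cosh_diff)
  then show "hyp_dist (axis_point s) (axis_point t) = \<bar>s - t\<bar>"
    unfolding hyp_dist_def using arcosh_cosh_real[of "\<bar>s - t\<bar>"] by simp
qed

lemma boost_axis_point: "boost L s *v axis_point t = axis_point (t + L)"
  by (auto simp: vec_eq_iff boost_def blk_vec axis_point_def sel_def cosh_add sinh_add)

text \<open>Quarter turns have order four, so the fourth power moves only the two coordinates of the
  axis plane.\<close>

lemma boost_power_4: "boost L 1 *v (boost L 1 *v (boost L 1 *v (boost L 1 *v x)))
    = blk (cosh (4 * L)) (sinh (4 * L)) (sinh (4 * L)) (cosh (4 * L)) 1 0 0 1 *v x"
proof -
  have 2: "boost L 1 ** boost L 1 = blk (cosh (2 * L)) (sinh (2 * L)) (sinh (2 * L)) (cosh (2 * L)) (-1) 0 0 (-1)"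
    unfolding boost_def blk_mult cosh_double sinh_double by (simp add: power2_eq_square mult_ac add_ac)
  have "4 * L = 2 * (2 * L)" by simp
  then have "(boost L 1 ** boost L 1) ** (boost L 1 ** boost L 1)
      = blk (cosh (4 * L)) (sinh (4 * L)) (sinh (4 * L)) (cosh (4 * L)) 1 0 0 1"
    unfolding 2 by (simp only: cosh_double sinh_double blk_mult) (simp add: power2_eq_square algebra_simps)
  then show ?thesis by (simp add: matrix_vector_mul_assoc matrix_mul_assoc)
qed

lemma lorentz_inner_boost:
  fixes x :: "real^('n option)"
  assumes "x \<in> hyp_space"
  shows "- lorentz_inner x (blk (cosh L) (sinh L) (sinh L) (cosh L) 1 0 0 1 *v x)
    = (1 + (\<Sum>i\<in>rest. (x $ i)\<^sup>2)) * cosh L - (\<Sum>i\<in>rest. (x $ i)\<^sup>2)"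
proof -
  let ?y = "blk (cosh L) (sinh L) (sinh L) (cosh L) 1 0 0 1 *v x"
  have rest: "(\<Sum>i\<in>rest. x $ i * ?y $ i) = (\<Sum>i\<in>rest. (x $ i)\<^sup>2)"
    by (rule sum.cong) (auto simp: blk_vec power2_eq_square)
  have h: "(x $ None)\<^sup>2 - (x $ p None)\<^sup>2 = 1 + (\<Sum>i\<in>rest. (x $ i)\<^sup>2)"
    using assms by (simp add: hyp_space_def lorentz_form_split)
  have "- lorentz_inner x ?y = ((x $ None)\<^sup>2 - (x $ p None)\<^sup>2) * cosh L - (\<Sum>i\<in>rest. (x $ i)\<^sup>2)"
    unfolding lorentz_inner_split rest by (simp add: blk_vec power2_eq_square algebra_simps)
  then show ?thesis unfolding h .
qed

lemma hyp_dist_boost: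
  fixes x :: "real^('n option)"
  assumes "x \<in> hyp_space" "hyp_dist x (blk (cosh L) (sinh L) (sinh L) (cosh L) 1 0 0 1 *v x) = d"
  shows "cosh d = (1 + (\<Sum>i\<in>rest. (x $ i)\<^sup>2)) * cosh L - (\<Sum>i\<in>rest. (x $ i)\<^sup>2)"
proof -
  let ?r = "\<Sum>i\<in>rest. (x $ i)\<^sup>2"
  have "?r \<ge> 0" by (intro sum_nonneg) simp
  then have "?r * (cosh L - 1) \<ge> 0" using cosh_real_ge_1[of L] by simp
  then have "(1 + ?r) * cosh L - ?r \<ge> 1" using cosh_real_ge_1[of L] by (simp add: algebra_simps)
  moreover have "d = arcosh ((1 + ?r) * cosh L - ?r)"
    using assms lorentz_inner_boost[OF assms(1)] by (simp add: hyp_dist_def)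
  ultimately show ?thesis by simp
qed

text \<open>A point at squared spatial distance \<open>r\<close> from the standard axis is moved by \<open>boost L 1 ^ (4 * k)\<close>
  by a distance \<open>d\<close> with \<open>cosh d = (1 + r) * cosh (4 * k * L) - r\<close>; comparing \<open>k = 1\<close> with \<open>k = 2\<close>
  on an invariant geodesic forces \<open>r = 0\<close>.\<close>

lemma translates_along_boost:
  assumes L: "L > 0" and l: "l > 0" and tr: "translates_along (boost L 1) X l"
  shows "l = L \<and> X = range axis_point"
proof -
  obtain c where c: "unit_speed_geodesic c" "range c = X" "\<And>t. boost L 1 *v c t = c (t + l)"
    using tr unfolding translates_along_def by blast
  have hyp: "c t \<in> hyp_space" and dist: "hyp_dist (c s) (c t) = \<bar>s - t\<bar>" for s t
    using c(1) unfolding unit_speed_geodesic_def by blast+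
  have c4: "blk (cosh (4 * L)) (sinh (4 * L)) (sinh (4 * L)) (cosh (4 * L)) 1 0 0 1 *v c t = c (t + 4 * l)" for t
    unfolding boost_power_4[symmetric] c(3) by (simp add: add.assoc)
  have key: "l = L \<and> (\<Sum>i\<in>rest. (c t $ i)\<^sup>2) = 0" for t
  proof -
    let ?r = "\<Sum>i\<in>rest. (c t $ i)\<^sup>2"
    let ?C = "cosh (4 * L)" and ?C' = "cosh (4 * l)"
    have d4: "?C' = (1 + ?r) * ?C - ?r"
      using hyp_dist_boost[OF hyp, of t "4 * L"] c4 dist l by simp
    have "blk (cosh (8 * L)) (sinh (8 * L)) (sinh (8 * L)) (cosh (8 * L)) 1 0 0 1
        = blk ?C (sinh (4 * L)) (sinh (4 * L)) ?C 1 0 0 1 ** blk ?C (sinh (4 * L)) (sinh (4 * L)) ?C 1 0 0 1"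
      using cosh_double[of "4 * L"] sinh_double[of "4 * L"] by (simp add: blk_mult power2_eq_square algebra_simps)
    then have "blk (cosh (8 * L)) (sinh (8 * L)) (sinh (8 * L)) (cosh (8 * L)) 1 0 0 1 *v c t = c (t + 8 * l)"
      using c4[of t] c4[of "t + 4 * l"] by (simp add: add.assoc flip: matrix_vector_mul_assoc)
    then have "hyp_dist (c t) (blk (cosh (8 * L)) (sinh (8 * L)) (sinh (8 * L)) (cosh (8 * L)) 1 0 0 1 *v c t) = 8 * l"
      using dist[of t "t + 8 * l"] l by simp
    then have d8: "cosh (8 * l) = (1 + ?r) * cosh (8 * L) - ?r" by (rule hyp_dist_boost[OF hyp])
    \<comment> \<open>Doubling turns \<open>d8\<close> into a second expression for C'^2. The two
      expressions differ by r (1 + r) (C - 1)^2, so C > 1 forces r = 0.\<close>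
    have dbl: "cosh (8 * x) = 2 * (cosh (4 * x))\<^sup>2 - 1" for x :: real
      using cosh_double_cosh[of "4 * x"] by simp
    have r0: "?r \<ge> 0" by (intro sum_nonneg) simp
    have C1: "?C > 1" using L cosh_real_strict_mono[of 0 "4 * L"] by simp
    have "?C'\<^sup>2 = (1 + ?r) * ?C\<^sup>2 - ?r"
      using d8 unfolding dbl by (simp add: algebra_simps)
    then have "((1 + ?r) * ?C - ?r)\<^sup>2 = (1 + ?r) * ?C\<^sup>2 - ?r" unfolding d4 .
    then have "?r * ((1 + ?r) * (?C - 1)\<^sup>2) = 0" by (simp add: power2_eq_square algebra_simps)
    moreover have "(1 + ?r) * (?C - 1)\<^sup>2 \<noteq> 0" using r0 C1 L by simp
    ultimately have r: "?r = 0" by simp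
    then have "?C' = ?C" using d4 by simp
    then have "l = L" using l L by simp
    then show ?thesis using r by simp
  qed
  have on_axis: "c t = axis_point (arsinh (c t $ p None))" for t
  proof -
    have "\<forall>i\<in>rest. (c t $ i)\<^sup>2 = 0" using key[of t] by (subst (asm) sum_nonneg_eq_0_iff) auto
    then have z: "c t $ i = 0" if "i \<noteq> None" "i \<noteq> p None" for i using that by auto
    have "(c t $ None)\<^sup>2 = 1 + (c t $ p None)\<^sup>2" "c t $ None > 0"
      using hyp[of t] key[of t] by (simp_all add: hyp_space_def lorentz_form_split)
    then have "c t $ None = cosh (arsinh (c t $ p None))"
      by (simp add: cosh_arsinh_real real_sqrt_unique add.commute)
    then show ?thesis unfolding vec_eq_iff axis_point_def sel_def using z by auto
  qed
  define f where "f = (\<lambda>t. arsinh (c t $ p None))"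
  have cf: "c t = axis_point (f t)" for t unfolding f_def by (rule on_axis)
  have iso: "\<bar>f s - f t\<bar> = \<bar>s - t\<bar>" for s t
    using dist[of s t] axis_point_geodesic unfolding cf unit_speed_geodesic_def by simp
  have "axis_point s \<in> X" for s
  proof -
    \<comment> \<open>An isometry of the line has slope 1 or -1, so the value s is taken at a or at
      -a.\<close>
    define a where "a = s - f 0"
    have "f a = s \<or> f (- a) = s" using iso[of a 0] iso[of "- a" 0] iso[of a "- a"] unfolding a_def by linarith
    then show ?thesis using cf c(2) by (metis rangeI)
  qed
  moreover have "X \<subseteq> range axis_point" using cf c(2) by auto
  ultimately show ?thesis using key by blast
qed

lemma hyperbolic_boost:
  assumes L: "L > 0"
  shows "hyperbolic_element (boost L 1)" "translation_length (boost L 1) = L"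
proof -
  have tr: "translates_along (boost L 1) (range axis_point) L"
    unfolding translates_along_def using axis_point_geodesic boost_axis_point by blast
  have "\<exists>!X. \<exists>l>0. translates_along (boost L 1) X l"
    using tr L translates_along_boost[OF L] by (intro ex1I[of _ "range axis_point"]) blast+
  then show "hyperbolic_element (boost L 1)" unfolding hyperbolic_element_def using boost_O_plus[of 1 L] by simp
  show "translation_length (boost L 1) = L"
    unfolding translation_length_def
    using tr L translates_along_boost[OF L] by (intro the_equality) blast+
qed

end

section \<open>The lattice\<close>

text \<open>For odd n the n + 1 coordinates can be halved; a bijection from \<open>S\<close> to its
  complement, glued with its inverse, is the involution.\<close>

lemma ex_index_pairing:
  assumes "odd CARD('n::finite)"
  obtains p :: "'n::finite option \<Rightarrow> 'n option" and S where "index_pairing p S"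
proof -
  obtain N where N: "CARD('n) = 2 * N + 1" using assms oddE by blast
  have "card (UNIV - {None :: 'n option}) = 2 * N + 1" using N by (simp add: card_Diff_singleton)
  then obtain S0 where S0: "S0 \<subseteq> UNIV - {None :: 'n option}" "card S0 = N" "finite S0"
    using obtain_subset_with_card_n[of N "UNIV - {None :: 'n option}"] by auto
  define S where "S = insert None S0"
  have cS: "card S = N + 1" using S0 by (auto simp: S_def card_insert_if)
  then have "card (- S) = N + 1" using N by (simp add: Compl_eq_Diff_UNIV card_Diff_subset)
  then obtain b where b: "bij_betw b S (- S)" using cS finite_same_card_bij[of S "- S"] by auto
  define p where "p i = (if i \<in> S then b i else inv_into S b i)" for i
  have "index_pairing p S"
  proof
    show "p (p i) = i" for i
    proof (cases "i \<in> S")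
      case True
      then show ?thesis using b bij_betwE[OF b] by (auto simp: p_def bij_betw_inv_into_left)
    next
      case False
      then have "inv_into S b i \<in> S" using bij_betwE[OF bij_betw_inv_into[OF b]] by blast
      then show ?thesis using False b by (simp add: p_def bij_betw_inv_into_right)
    qed
    show "p i \<in> S \<longleftrightarrow> i \<notin> S" for i
      using bij_betwE[OF b] bij_betwE[OF bij_betw_inv_into[OF b]] by (auto simp: p_def)
    show "None \<in> S" by (simp add: S_def)
  qed
  then show ?thesis using that by blast
qed

lemma subgroup_GL_real_conj:
  fixes M :: "real^'k::finite^'k"
  assumes H: "subgroup H GL_real" and M: "invertible M"
  shows "subgroup ((\<lambda>T. matrix_inv M ** T ** M) ` H) GL_real"
proof (rule subgroup.intro)
  note MM = matrix_inv_inverse[OF M]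
  have HC: "invertible T" if "T \<in> H" for T using subgroup.mem_carrier[OF H that] by simp
  have inv: "invertible (matrix_inv M ** T ** M)" if "T \<in> H" for T
    using HC[OF that] M by (simp add: invertible_mult invertible_matrix_inv)
  then show "(\<lambda>T. matrix_inv M ** T ** M) ` H \<subseteq> carrier GL_real" by auto
  show "\<one>\<^bsub>GL_real\<^esub> \<in> (\<lambda>T. matrix_inv M ** T ** M) ` H"
    using subgroup.one_closed[OF H] MM by (intro image_eqI[of _ _ "mat 1"]) simp_all
  fix x assume "x \<in> (\<lambda>T. matrix_inv M ** T ** M) ` H"
  then obtain S where S: "S \<in> H" "x = matrix_inv M ** S ** M" by blast
  have "inv\<^bsub>GL_real\<^esub> x = matrix_inv M ** matrix_inv S ** M"
    unfolding S(2) inv_GL_real[OF inv[OF S(1)]] using M HC[OF S(1)]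
    by (simp add: matrix_inv_mult invertible_mult invertible_matrix_inv matrix_mul_assoc)
  moreover have "matrix_inv S \<in> H" using subgroup.m_inv_closed[OF H S(1)] inv_GL_real[OF HC[OF S(1)]] by simp
  ultimately show "inv\<^bsub>GL_real\<^esub> x \<in> (\<lambda>T. matrix_inv M ** T ** M) ` H" by blast
  fix y assume "y \<in> (\<lambda>T. matrix_inv M ** T ** M) ` H"
  then obtain T where T: "T \<in> H" "y = matrix_inv M ** T ** M" by blast
  have "x ** y = matrix_inv M ** S ** (M ** matrix_inv M) ** T ** M"
    unfolding S(2) T(2) by (simp add: matrix_mul_assoc)
  then have "x ** y = matrix_inv M ** (S ** T) ** M" unfolding MM by (simp add: matrix_mul_assoc)
  moreover have "S ** T \<in> H" using subgroup.m_closed[OF H S(1) T(1)] by simp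
  ultimately show "x \<otimes>\<^bsub>GL_real\<^esub> y \<in> (\<lambda>T. matrix_inv M ** T ** M) ` H" by auto
qed

section \<open>The explicit matrices and the final assembly\<close>

context index_pairing
begin

lemma blk_cong:
  "a = a' \<Longrightarrow> b = b' \<Longrightarrow> c = c' \<Longrightarrow> d = d' \<Longrightarrow> e = e' \<Longrightarrow> f = f' \<Longrightarrow> g = g' \<Longrightarrow> h = h' \<Longrightarrow>
    blk a b c d e f g h = blk a' b' c' d' e' f' g' h'"
  by simp

lemma lorentz_signature:
  fixes A M :: "real^('n option)^('n option)"
  assumes M: "invertible M" and form: "transpose M ** A ** M = blk (-1) 0 0 1 1 0 0 1"
  shows "has_signature A CARD('n) 1"
  unfolding has_signature_def
proof (intro conjI exI[of _ M])
  have nth: "(transpose M ** A ** M) $ i $ j = (if j = i then if i = None then -1 else 1 else 0)" for i j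
    unfolding form by (auto simp: blk_def pair_matrix_def sel_def)
  show "\<forall>i j. i \<noteq> j \<longrightarrow> (transpose M ** A ** M) $ i $ j = 0" unfolding nth by simp
  have "{i. (transpose M ** A ** M) $ i $ i > 0} = UNIV - {None}" unfolding nth by auto
  then show "card {i. (transpose M ** A ** M) $ i $ i > 0} = CARD('n)" by (simp add: card_Diff_singleton)
  have "{i. (transpose M ** A ** M) $ i $ i < 0} = {None}" unfolding nth by auto
  then show "card {i. (transpose M ** A ** M) $ i $ i < 0} = 1" by simp
qed (use M in simp_all)

text \<open>In the first block, \<open>x\<^sup>2 + y x x' + x'\<^sup>2\<close> is the norm of \<open>x + lam * x'\<close>, and \<open>T\<close> is multiplication
  by \<open>1 + lam\<close>, of norm \<open>y + 2\<close>; its square is \<open>y + 2\<close> times the multiplication by \<open>lam\<close>.\<close>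

lemma salem_square_root_lattice:
  assumes lam: "salem_number lam"
  shows "\<exists>\<Gamma> :: (real^('n option)^('n option)) set.
    simplest_type_lattice (rat_adjoin (lam + inverse lam)) \<Gamma> \<and>
    (\<exists>\<gamma>\<in>\<Gamma>. hyperbolic_element \<gamma> \<and> sqrt lam = exp (translation_length \<gamma>))"
proof -
  define y where "y = lam + inverse lam"
  define K where "K = rat_adjoin y"
  define R where "R = ring_of_integers K"
  define r where "r = sqrt (y + 2)"
  define D where "D = lam - inverse lam"
  define A where "A = blk 1 (y / 2) (y / 2) 1 1 0 0 (y + 2)"
  \<comment> \<open>The first columns are orthonormal for the form: (1, 0) has value 1, and (-y,
    2)/D is orthogonal to it with value (4 - y^2)/D^2 = -1, as D^2 = y^2 - 4. On the other pairs
    only v is rescaled, by 1/r.\<close>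
  define M where "M = blk (- (y / D)) 1 (2 / D) 0 1 0 0 (1 / r)"
  define M' where "M' = blk 0 (D / 2) 1 (y / 2) 1 0 0 r"
  \<comment> \<open>The first block has as columns the coordinates of 1 + lam and (1 + lam) lam = -1
    + (1 + y) lam in the basis 1, lam, by lam^2 = y lam - 1.\<close>
  define T where "T = blk 1 (-1) 1 (1 + y) 0 (- (y + 2)) 1 0"
  \<comment> \<open>The blockwise adjugate of \<open>T\<close>; both kinds of block in
    \<open>T\<close> have determinant y + 2.\<close>
  define U where "U = blk (1 + y) 1 (-1) 1 0 (y + 2) (-1) 0"
  define L where "L = ln (sqrt lam)"
  have lam1: "lam > 1" using lam by (simp add: salem_number_def)
  have y2: "y > 2" using salem_trace_gt_2[OF lam] by (simp add: y_def)
  have r: "r > 0" "r * r = y + 2" using y2 by (auto simp: r_def)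
  have "inverse lam < 1" using lam1 by (simp add: inverse_less_1_iff)
  then have D: "D > 0" using lam1 by (simp add: D_def)
  have DD: "D * D = y * y - 4" using lam1 by (simp add: D_def y_def algebra_simps)
  have tot: "totally_real_number_field K"
    using salem_trace_field_totally_real[OF lam] by (simp add: K_def y_def)
  then have nf: "number_field K" and sub: "real_subfield K"
    by (simp_all add: totally_real_number_field_def number_field_def)
  have ring: "real_subring R" unfolding R_def by (rule real_subring_ring_of_integers[OF sub])
  have yK: "y \<in> K" by (simp add: K_def mem_rat_adjoin)
  have yR: "y \<in> R" using yK algebraic_int_salem_trace[OF lam] by (simp add: R_def ring_of_integers_def y_def)
  have R01: "0 \<in> R" "1 \<in> R" "-1 \<in> R" using ring by (auto simp: real_subring_def)
  then have "1 + 1 \<in> R" using ring unfolding real_subring_def by blast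
  then have y12: "1 + y \<in> R" "y + 2 \<in> R" "- (y + 2) \<in> R" "- y - 2 \<in> R"
    using ring yR R01 unfolding real_subring_def by (auto simp del: minus_add_distrib) (metis minus_add_distrib uminus_add_conv_diff add.commute)
  have MM': "M ** M' = mat 1"
    unfolding M_def M'_def blk_mult blk_1[symmetric] using D r by (intro blk_cong) simp_all
  have M: "invertible M" and Minv: "matrix_inv M = M'" using matrix_inv_eqI[OF MM'] by auto
  have form: "transpose M ** A ** M = blk (-1) 0 0 1 1 0 0 1"
    unfolding M_def A_def transpose_blk blk_mult using D r DD y2
    by (intro blk_cong) (simp_all add: field_simps)
  have sym: "transpose A = A" by (simp add: A_def blk_symmetric)
  have iso: "qform A (M *v x) = lorentz_form x" for x
    unfolding qform_congruence form lorentz_form_eq_qform ..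
  define t where "t = (1 / r) *\<^sub>R T"
  have "exp L = sqrt lam" using lam1 by (simp add: L_def)
  then have ch: "2 * cosh L = sqrt lam + inverse (sqrt lam)" and sh: "2 * sinh L = sqrt lam - inverse (sqrt lam)"
    by (simp_all add: cosh_field_def sinh_field_def exp_minus)
  \<comment> \<open>The scalar \<open>r\<close> is the trace of the hyperbolic block: (2 cosh L)^2 =
    lam + 2 + 1/lam.\<close>
  have "(2 * cosh L)\<^sup>2 = y + 2"
    unfolding ch y_def using lam1 by (simp add: power2_eq_square algebra_simps flip: real_sqrt_mult inverse_mult_distrib)
  then have "2 * cosh L = r" unfolding r_def by (intro real_sqrt_unique[symmetric]) simp_all
  moreover have "(2 * sinh L) * (2 * cosh L) = D"
    unfolding ch sh D_def using lam1 by (simp add: algebra_simps flip: real_sqrt_mult inverse_mult_distrib)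
  ultimately have cs: "cosh L = r / 2" "sinh L = D / (2 * r)" using r by (simp_all add: field_simps)
  \<comment> \<open>The one entry of the matrix identity \<open>Mb\<close> that uses D^2 = y^2 -
    4.\<close>
  have e: "- (y / D) * (r / 2) + 1 * (D / (2 * r)) = 1 / r * 1 * (- (y / D)) + 1 / r * (-1) * (2 / D)"
  proof -
    have "- (y / D) * (r / 2) + 1 * (D / (2 * r)) = (D * D - y * (r * r)) / (2 * r * D)"
      using D r(1) by (simp add: field_simps)
    also have "\<dots> = (- 2 * (y + 2)) / (2 * r * D)" unfolding DD r(2) by (simp add: algebra_simps)
    also have "\<dots> = 1 / r * 1 * (- (y / D)) + 1 / r * (-1) * (2 / D)"
      using D r(1) by (simp add: field_simps)
    finally show ?thesis .
  qed
  have Mb: "M ** boost L 1 = t ** M"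
    unfolding t_def T_def M_def boost_def scaleR_blk blk_mult cs
    by (intro blk_cong, rule e) (use D r y2 in \<open>simp_all add: field_simps\<close>)
  have conj: "M ** boost L 1 ** matrix_inv M = t"
    unfolding Mb using matrix_inv_inverse(1)[OF M] by (simp flip: matrix_mul_assoc)
  then have tA: "t \<in> O_prime A UNIV"
    using O_prime_UNIV_conj_iff[OF M sym iso invertible_boost[of 1 L]] boost_O_plus[of 1 L] by simp
  have UT: "U ** T = (y + 2) *\<^sub>R mat 1"
    unfolding U_def T_def blk_mult blk_1[symmetric] scaleR_blk by (intro blk_cong) simp_all
  \<comment> \<open>Every block of the square has determinant 1, so that its inverse is integral as
    well.\<close>
  have tt_eq: "t ** t = blk 0 (-1) 1 y (-1) 0 0 (-1)"
  proof -
    have "T ** T = (y + 2) *\<^sub>R blk 0 (-1) 1 y (-1) 0 0 (-1)"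
      unfolding T_def scaleR_blk blk_mult by (intro blk_cong) (simp_all add: algebra_simps)
    moreover have "t ** t = (1 / (r * r)) *\<^sub>R (T ** T)" by (simp add: t_def scaleR_matrix_mult)
    ultimately show ?thesis using y2 by (simp add: r(2))
  qed
  have tt_inv: "t ** t ** blk y 1 (-1) 0 (-1) 0 0 (-1) = mat 1"
    unfolding tt_eq blk_mult blk_1[symmetric] by (intro blk_cong) simp_all
  have tt: "t ** t \<in> O_prime A R"
  proof -
    have "t ** t \<in> O_prime A UNIV"
      using subgroup.m_closed[OF subgroup_O_prime tA tA] by (simp add: real_subring_def)
    moreover have "t ** t \<in> GL_over R"
      unfolding GL_over_iff matrix_inv_eqI(2)[OF tt_inv] unfolding tt_eq
      using matrix_inv_eqI(1)[OF tt_inv] R01 yR by (simp add: tt_eq matrix_over_blk)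
    ultimately show ?thesis using O_prime_eq by blast
  qed
  have TU: "matrix_over R T" "matrix_over R U"
    unfolding T_def U_def using R01 y12 by (auto intro!: matrix_over_blk)
  have "y + 2 \<in> ring_of_integers K" "y + 2 \<noteq> 0" using y12 y2 by (simp_all add: R_def)
  then obtain X where X: "finite X" "\<And>x. x \<in> R \<Longrightarrow> \<exists>k\<in>X. \<exists>m\<in>R. x = k + (y + 2) * m"
    using ring_of_integers_finite_quotient[OF nf] unfolding R_def by metis
  obtain G' where G': "subgroup G' GL_real" "G' \<subseteq> O_prime A UNIV" "t \<in> G'"
    "commensurable GL_real G' (O_prime A R)"
    using commensurable_extension[OF ring X TU t_def _ _ UT tA tt] r y2 by auto
  define \<Gamma> where "\<Gamma> = (\<lambda>T. matrix_inv M ** T ** M) ` G'"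
  have conj_back: "M ** (matrix_inv M ** g ** M) ** matrix_inv M = g" for g
  proof -
    have "M ** (matrix_inv M ** g ** M) ** matrix_inv M = (M ** matrix_inv M) ** g ** (M ** matrix_inv M)"
      by (simp add: matrix_mul_assoc)
    then show ?thesis unfolding matrix_inv_inverse[OF M] by simp
  qed
  have "(\<lambda>T. M ** T ** matrix_inv M) ` \<Gamma> = G'" unfolding \<Gamma>_def image_image conj_back by simp
  moreover have "\<Gamma> \<subseteq> O_plus"
  proof
    fix g assume "g \<in> \<Gamma>"
    then obtain h where h: "h \<in> G'" "g = matrix_inv M ** h ** M" by (auto simp: \<Gamma>_def)
    have "invertible h" using subgroup.mem_carrier[OF G'(1) h(1)] by simp
    then have "invertible g" using M h(2) by (simp add: invertible_mult invertible_matrix_inv)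
    then show "g \<in> O_plus" using O_prime_UNIV_conj_iff[OF M sym iso, of g] conj_back[of h] h G'(2) by auto
  qed
  moreover have "admissible_form K A"
    unfolding admissible_form_def
  proof (intro conjI allI impI)
    have "matrix_over K A"
    proof -
      have K01: "0 \<in> K" "1 \<in> K" "1 + 1 \<in> K" using sub unfolding real_subfield_def by blast+
      then have "inverse (1 + 1) \<in> K" using sub unfolding real_subfield_def by blast
      then have "y * inverse (1 + 1) \<in> K" "y + (1 + 1) \<in> K" using sub yK K01 unfolding real_subfield_def by blast+
      then have "y / 2 \<in> K" "y + 2 \<in> K" by simp_all
      then show ?thesis unfolding A_def using K01(1,2) by (intro matrix_over_blk)
    qed
    then show "A $ i $ j \<in> K" for i j by (simp add: matrix_over_def)
    show "transpose A = A" by (rule sym)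
    show "has_signature A CARD('n) 1" by (rule lorentz_signature[OF M form])
    fix \<sigma> :: "real \<Rightarrow> real" assume s: "field_embedding K \<sigma> \<and> (\<exists>x\<in>K. \<sigma> x \<noteq> x)"
    then have t2: "\<bar>\<sigma> y\<bar> < 2"
      using salem_trace_nonidentity_embedding[OF lam] unfolding K_def y_def by blast
    have emb: "field_embedding K \<sigma>" using s by blast
    have s0: "\<sigma> 0 = 0" "\<sigma> 1 = 1" using field_embedding_of_rat(2)[OF sub emb, of 0]
      field_embedding_of_rat(2)[OF sub emb, of 1] by simp_all
    have "\<sigma> (rpoly [:0, 1/2:] y) = rpoly [:0, 1/2:] (\<sigma> y)" "\<sigma> (rpoly [:2, 1:] y) = rpoly [:2, 1:] (\<sigma> y)"
      using field_embedding_rpoly(2)[OF sub emb yK] by blast+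
    then have sy: "\<sigma> (y / 2) = \<sigma> y / 2" "\<sigma> (y + 2) = \<sigma> y + 2"
      by (simp_all add: rpoly_pCons of_rat_divide add.commute)
    have "(\<chi> i j. \<sigma> (A $ i $ j)) = blk 1 (\<sigma> y / 2) (\<sigma> y / 2) 1 1 0 0 (\<sigma> y + 2)"
      unfolding A_def map_blk[of \<sigma>, OF s0(1)] s0 sy ..
    then show "positive_definite (\<chi> i j. \<sigma> (A $ i $ j))"
      using positive_definite_blk[OF t2, of "\<sigma> y + 2"] t2 by simp
  qed
  ultimately have "simplest_type_lattice K \<Gamma>"
    unfolding simplest_type_lattice_def
    using tot subgroup_GL_real_conj[OF G'(1) M, folded \<Gamma>_def] M iso G'(4)
    by (intro conjI exI[of _ A] exI[of _ M]) (simp_all add: R_def)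
  moreover have "boost L 1 \<in> \<Gamma>"
  proof -
    have "matrix_inv M ** t ** M = (matrix_inv M ** M) ** boost L 1 ** (matrix_inv M ** M)"
      unfolding conj[symmetric] by (simp add: matrix_mul_assoc)
    then have "boost L 1 = matrix_inv M ** t ** M" unfolding matrix_inv_inverse[OF M] by simp
    then show ?thesis unfolding \<Gamma>_def using G'(3) by blast
  qed
  moreover have "L > 0" using lam1 by (simp add: L_def)
  ultimately show ?thesis
    using hyperbolic_boost[of L] \<open>exp L = sqrt lam\<close> unfolding K_def y_def by metis
qed

end

theorem corollary1p7:
  fixes lam :: real
  assumes "salem_number lam"
    and "odd CARD('n::finite)" and "CARD('n) \<ge> 3"
  shows "\<exists>\<Gamma> :: (real^('n option)^('n option)) set.
           simplest_type_lattice (rat_adjoin (lam + inverse lam)) \<Gamma> \<and>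
           (\<exists>\<gamma>\<in>\<Gamma>. hyperbolic_element \<gamma> \<and> sqrt lam = exp (translation_length \<gamma>))"
proof -
  obtain p :: "'n option \<Rightarrow> 'n option" and S where "index_pairing p S"
    using ex_index_pairing[OF assms(2)] by blast
  then interpret index_pairing p S .
  show ?thesis by (rule salem_square_root_lattice[OF assms(1)])
qed

end
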